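(* Let $L=\mathbb{Q}(\alpha)$ be a cubic number field, where $\alpha$ is a root of $f(x)=x^3-ax+b$ with $a,b\in\mathbb{Z}$ such that for every prime $p$ one has $v_p(a)<2$ or $v_p(b)<3$. Let $g=\gcd(a,b)$, let $H$ be the unique Hopf-Galois structure on $L$, with $\mathbb{Q}$-basis $W=\{w_1,w_2,w_3\}$, $w_1=\mathrm{Id}$, $w_2=z(\sigma-\sigma^2)$, $w_3=\sigma+\sigma^2$. Suppose that $3\nmid a$. Then $I_W(\mathbb{Z}[\alpha])=2g$, and a $\mathbb{Z}$-basis of $\mathfrak{A}_H(\mathbb{Z}[\alpha])$ is: 1. $\left\{w_1,\frac{w_2}{g},\frac{-w_2+gw_3}{2g}\right\}$ if $v_2(a)\ge v_2(b)$; 2. $\left\{w_1,\frac{w_2}{2g},w_3\right\}$ if $v_2(a)<v_2(b)$.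
   Context: $v_p$ is the $p$-adic valuation, with $v_p(0)=\infty$. Let $\widetilde{L}$ be the normal closure of $L$, $G=\mathrm{Gal}(\widetilde L/\mathbb{Q})$, $G'=\mathrm{Gal}(\widetilde L/L)$, $\alpha_1=\alpha,\alpha_2,\alpha_3\in\widetilde L$ the roots of $f$, $z=\sqrt{4a^3-27b^2}\in\widetilde L$, $M=\mathbb{Q}(z)$, and $\sigma\in G$ the element acting on the roots as the cycle $(\alpha_1,\alpha_2,\alpha_3)$; $J=\langle\sigma\rangle$. The unique Hopf-Galois structure on $L$ is $H=M[J]^{G'}$, where $G'$ acts on $M$ by Galois action and on $J$ by conjugation; $h=\sum_ih_i\sigma^i\in H$ acts on $x\in L$ by $h\cdot x=\sum_ih_i\sigma^i(x)$ (if $L/\mathbb{Q}$ is Galois, $H=\mathbb{Q}[G]$). The associated order is $\mathfrak{A}_H(\mathbb{Z}[\alpha])=\{h\in H\mid h\cdot\mathbb{Z}[\alpha]\subseteq\mathbb{Z}[\alpha]\}$. $I_W(\mathbb{Z}[\alpha])$ is the (generalized) index $[\mathfrak{A}_H(\mathbb{Z}[\alpha]):\langle W\rangle_{\mathbb{Z}}]$, i.e. the absolute value of the determinant of the matrix expressing $W$ in terms of a $\mathbb{Z}$-basis of $\mathfrak{A}_H(\mathbb{Z}[\alpha])$. *)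

theory Defs
  imports
    "HOL-Algebra.Algebraic_Closure_Type"
    "HOL-Algebra.Generated_Fields"
    "HOL-Algebra.Generated_Groups"
    "HOL-Algebra.Bij"
    "HOL-Library.Poly_Mapping"
    "HOL-Library.Extended_Nat"
    "HOL-Analysis.Analysis"
    "HOL-Computational_Algebra.Computational_Algebra"
begin

text \<open>
  All fields are subfields of an arbitrary ambient field of characteristic 0, the type
  \<open>'a\<close>; nothing is assumed about it (it need not be algebraically closed, and it may be the
  normal closure itself). The prime field of \<open>'a\<close> is \<^term>\<open>\<rat> :: 'a::field_char_0 set\<close>.
\<close>

definition vp :: "nat \<Rightarrow> int \<Rightarrow> enat" where
  "vp p x = (if x = 0 then \<infinity> else enat (multiplicity (int p) x))"

subsection \<open>Number fields and normal closures\<close>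

abbreviation amb :: "'a::field_char_0 ring" where
  "amb \<equiv> ring_of_type_algebra"

definition rat_adjoin :: "'a::field_char_0 set \<Rightarrow> 'a set" where
  "rat_adjoin S = generate_field amb S"

definition rat_degree :: "'a::field_char_0 set \<Rightarrow> nat" where
  "rat_degree K = vector_space.dim (\<lambda>(q::rat) (x::'a). of_rat q * x) K"

definition int_adjoin :: "'a::field_char_0 \<Rightarrow> 'a set" where
  "int_adjoin x = {poly (map_poly of_int p) x | p :: int poly. True}"

definition splits_in :: "'a::field_char_0 set \<Rightarrow> rat poly \<Rightarrow> bool" where
  "splits_in E p \<longleftrightarrow>
     (\<exists>rs. set rs \<subseteq> E \<and>
        map_poly of_rat p = smult (of_rat (lead_coeff p)) (\<Prod>r\<leftarrow>rs. [:- r, 1:]))"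

definition normal_over_rat :: "'a::field_char_0 set \<Rightarrow> bool" where
  "normal_over_rat E \<longleftrightarrow>
     subfield E amb \<and> (\<forall>x\<in>E. algebraic x) \<and>
     (\<forall>p :: rat poly. irreducible p \<and> (\<exists>x\<in>E. poly (map_poly of_rat p) x = 0) \<longrightarrow> splits_in E p)"

definition is_normal_closure :: "'a::field_char_0 set \<Rightarrow> 'a set \<Rightarrow> bool" where
  "is_normal_closure K N \<longleftrightarrow>
     K \<subseteq> N \<and> normal_over_rat N \<and>
     (\<forall>N'. K \<subseteq> N' \<and> N' \<subseteq> N \<and> normal_over_rat N' \<longrightarrow> N' = N)"

text \<open>
  As in \<^const>\<open>BijGroup\<close>, the automorphisms of \<open>E\<close> are represented by functions that are
  \<open>undefined\<close> outside \<open>E\<close>, so that equality of functions is equality of automorphisms.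
\<close>

definition Gal :: "'a::field_char_0 set \<Rightarrow> 'a set \<Rightarrow> ('a \<Rightarrow> 'a) monoid" where
  "Gal E K = (BijGroup E)
     \<lparr>carrier := {s \<in> Bij E. s \<in> ring_hom (amb\<lparr>carrier := E\<rparr>) (amb\<lparr>carrier := E\<rparr>) \<and>
                    (\<forall>x\<in>K. s x = x)}\<rparr>"

subsection \<open>The Hopf-Galois structure\<close>

text \<open>
  The element \<open>\<Sum>\<^sub>j h\<^sub>j j\<close> of a group ring is the finitely supported function mapping the group
  element \<open>j\<close> to its coefficient \<open>h\<^sub>j\<close>.
\<close>

definition cscale :: "'a::field_char_0 \<Rightarrow> ('g \<Rightarrow>\<^sub>0 'a) \<Rightarrow> ('g \<Rightarrow>\<^sub>0 'a)" where
  "cscale c h = Poly_Mapping.map (\<lambda>x. c * x) h"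

definition group_ring :: "'a::field_char_0 set \<Rightarrow> 'g set \<Rightarrow> ('g \<Rightarrow>\<^sub>0 'a) set" where
  "group_ring M J = {h. Poly_Mapping.keys h \<subseteq> J \<and> (\<forall>j\<in>J. Poly_Mapping.lookup h j \<in> M)}"

text \<open>An element of \<open>G\<close> acts on coefficients by evaluation and on group elements by conjugation.\<close>

definition galois_act ::
    "('a \<Rightarrow> 'a) monoid \<Rightarrow> ('a \<Rightarrow> 'a) \<Rightarrow> (('a \<Rightarrow> 'a) \<Rightarrow>\<^sub>0 'a::field_char_0) \<Rightarrow> (('a \<Rightarrow> 'a) \<Rightarrow>\<^sub>0 'a)" where
  "galois_act G \<tau> h =
     (\<Sum>j\<in>Poly_Mapping.keys h. Poly_Mapping.single (\<tau> \<otimes>\<^bsub>G\<^esub> j \<otimes>\<^bsub>G\<^esub> inv\<^bsub>G\<^esub> \<tau>) (\<tau> (Poly_Mapping.lookup h j)))"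

text \<open>
  \<open>hopf_galois N L M \<sigma>\<close> is \<open>M[J]\<^sup>G\<^sup>'\<close> with \<open>J = \<langle>\<sigma>\<rangle>\<close> inside \<open>G = Gal(N/\<rat>)\<close> and \<open>G' = Gal(N/L)\<close>.
\<close>

definition hopf_galois ::
    "'a::field_char_0 set \<Rightarrow> 'a set \<Rightarrow> 'a set \<Rightarrow> ('a \<Rightarrow> 'a) \<Rightarrow> (('a \<Rightarrow> 'a) \<Rightarrow>\<^sub>0 'a) set" where
  "hopf_galois N L M \<sigma> =
     {h \<in> group_ring M (generate (Gal N \<rat>) {\<sigma>}).
        \<forall>\<tau>\<in>carrier (Gal N L). galois_act (Gal N \<rat>) \<tau> h = h}"

definition hopf_act :: "(('a \<Rightarrow> 'a) \<Rightarrow>\<^sub>0 'a::field_char_0) \<Rightarrow> 'a \<Rightarrow> 'a" where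
  "hopf_act h x = (\<Sum>j\<in>Poly_Mapping.keys h. Poly_Mapping.lookup h j * j x)"

definition assoc_order ::
    "(('a \<Rightarrow> 'a) \<Rightarrow>\<^sub>0 'a::field_char_0) set \<Rightarrow> 'a set \<Rightarrow> (('a \<Rightarrow> 'a) \<Rightarrow>\<^sub>0 'a) set" where
  "assoc_order H A = {h \<in> H. \<forall>x\<in>A. hopf_act h x \<in> A}"

subsection \<open>Integral bases and the generalized index\<close>

definition zscale :: "int \<Rightarrow> ('g \<Rightarrow>\<^sub>0 'a::field_char_0) \<Rightarrow> ('g \<Rightarrow>\<^sub>0 'a)" where
  "zscale n = cscale (of_int n)"

lemma lookup_zscale: "Poly_Mapping.lookup (zscale n h) k = of_int n * Poly_Mapping.lookup h k"
  by (simp add: zscale_def cscale_def Poly_Mapping.map.rep_eq when_def)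

lemma module_zscale: "Modules.module (zscale :: int \<Rightarrow> ('g \<Rightarrow>\<^sub>0 'a::field_char_0) \<Rightarrow> _)"
  by standard (auto intro!: poly_mapping_eqI simp: lookup_zscale lookup_add algebra_simps)

definition is_int_basis :: "('g \<Rightarrow>\<^sub>0 'a::field_char_0) set \<Rightarrow> ('g \<Rightarrow>\<^sub>0 'a) ^ 'n \<Rightarrow> bool" where
  "is_int_basis A v \<longleftrightarrow>
     inj (\<lambda>i. v $ i) \<and> \<not> module.dependent zscale (range (\<lambda>i. v $ i)) \<and>
     module.span zscale (range (\<lambda>i. v $ i)) = A"

text \<open>
  The description operator commits to the value being independent of the chosen basis \<open>v\<close>.
  The matrix \<open>P\<close> is rational: \<open>w\<close> need not lie in \<open>A\<close>.
\<close>

definition gen_index :: "('g \<Rightarrow>\<^sub>0 'a::field_char_0) set \<Rightarrow> ('g \<Rightarrow>\<^sub>0 'a) ^ 'n \<Rightarrow> rat" where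
  "gen_index A w =
     (THE d. \<exists>(v :: ('g \<Rightarrow>\<^sub>0 'a) ^ 'n) (P :: rat ^ 'n ^ 'n).
        is_int_basis A v \<and>
        (\<forall>j. w $ j = (\<Sum>i\<in>UNIV. cscale (of_rat (P $ i $ j)) (v $ i))) \<and>
        d = \<bar>det P\<bar>)"

end

(*
Every element of the normal closure N is u(alpha) + v(alpha) z with u, v rational polynomials of
degree at most 2. To see that the set of these elements is already normal over the rationals,
evaluate such an expression at the six pairs (alpha_i, +-z): all power sums of the six values are
rational, hence by Newton's identities so are the coefficients of the monic polynomial with these
roots. Therefore an automorphism is determined by its values at alpha and z, sigma has order 3, and
Gal(N/L) is trivial or generated by an involution that sends z to -z and inverts sigma; in both
cases H is the rational span of w_1, w_2, w_3. With z = e (alpha_1 - alpha_2) (alpha_1 - alpha_3)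
(alpha_2 - alpha_3), e = +-1,

  w_2 alpha = e (6 a alpha^2 + 9 b alpha - 4 a^2),  w_2 alpha^2 = e (6 a b - 2 a^2 alpha - 9 b alpha^2),
  w_3 alpha = - alpha,                              w_3 alpha^2 = 2 a - alpha^2,

so x w_1 + y w_2 + t w_3 preserves Z[alpha] iff seven rational linear forms in x, y, t are integral.
Since 3 does not divide a, this means x = k, y = m / (2 g), t = n / 2 with integers k, m, n such that
n - (b / g) m is even.
*)
theory Submission
  imports Defs
begin

section \<open>Subfields of the ambient field\<close>

text \<open>The ambient field may be no larger than N, and N may equal L, so conjugates cannot be
  obtained by extending embeddings. They come from substitution instead: if an irreducible rational
  polynomial shares one root with a rational polynomial, all its roots are roots of the latter.
  Minimality of N then turns "normal field inside N" into "equal to N". The one automorphism built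
  by hand is z -> -z over L, for z irrational; if z is rational, then M is the prime field and every
  element of M[J] already has the required shape.

  In the lattice, 3 not dividing a serves to strip the factors 3 and 9 from the linear forms, so
  only the prime 2 remains. In the coordinates x, y, t, the condition on n - (b / g) m cuts a
  sublattice of index 2 out of Z x (1 / (2 g)) Z x (1 / 2) Z, whatever the parity of b / g. The span
  of W is Z x Z x Z, of index 4 g in the big lattice, which explains the uniform index 2 g. Only the
  shape of a basis depends on the parity of b / g, and b / g is odd exactly when v_2(a) >=
  v_2(b).\<close>

lemma amb_simps [simp]:
  "carrier amb = UNIV" "x \<otimes>\<^bsub>amb\<^esub> y = x * y" "x \<oplus>\<^bsub>amb\<^esub> y = x + y"
  "\<one>\<^bsub>amb\<^esub> = 1" "\<zero>\<^bsub>amb\<^esub> = 0"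
  by (simp_all add: ring_of_type_algebra_def)

lemma field_amb: "field (amb :: 'a::field_char_0 ring)"
  by (rule field_from_type_algebra)

lemma a_inv_amb [simp]: "\<ominus>\<^bsub>amb\<^esub> (x::'a::field_char_0) = - x"
proof -
  interpret field "amb :: 'a ring" by (rule field_amb)
  show ?thesis by (rule minus_equality) simp_all
qed

lemma m_inv_amb [simp]:
  assumes "(x::'a::field_char_0) \<noteq> 0" shows "inv\<^bsub>amb\<^esub> x = inverse x"
proof -
  interpret field "amb :: 'a ring" by (rule field_amb)
  show ?thesis using assms by (intro comm_inv_char) simp_all
qed

lemma subfield_ambI:
  fixes K :: "'a::field_char_0 set"
  assumes "1 \<in> K" "\<And>x y. x \<in> K \<Longrightarrow> y \<in> K \<Longrightarrow> x + y \<in> K" "\<And>x. x \<in> K \<Longrightarrow> - x \<in> K"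
    "\<And>x y. x \<in> K \<Longrightarrow> y \<in> K \<Longrightarrow> x * y \<in> K" "\<And>x. x \<in> K \<Longrightarrow> inverse x \<in> K"
  shows "subfield K amb"
proof -
  interpret field "amb :: 'a ring" by (rule field_amb)
  show ?thesis
    by (intro subfieldI' subringI) (use assms in auto)
qed

lemma subfield_ambD:
  fixes K :: "'a::field_char_0 set"
  assumes "subfield K amb"
  shows "1 \<in> K" "x \<in> K \<Longrightarrow> y \<in> K \<Longrightarrow> x + y \<in> K" "x \<in> K \<Longrightarrow> - x \<in> K"
    "x \<in> K \<Longrightarrow> y \<in> K \<Longrightarrow> x * y \<in> K" "x \<in> K \<Longrightarrow> y \<in> K \<Longrightarrow> x - y \<in> K"
    "x \<in> K \<Longrightarrow> inverse x \<in> K" "x \<in> K \<Longrightarrow> y \<in> K \<Longrightarrow> x / y \<in> K"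
    "of_rat q \<in> K"
proof -
  interpret field "amb :: 'a ring" by (rule field_amb)
  note sr = subringE[OF subfieldE(1)[OF assms], simplified]
  show one: "1 \<in> K" using sr(3) by simp
  show add: "x + y \<in> K" if "x \<in> K" "y \<in> K" for x y using sr(7) that by blast
  show uminus: "- x \<in> K" if "x \<in> K" for x using sr(5) that by auto
  show mult: "x * y \<in> K" if "x \<in> K" "y \<in> K" for x y using sr(6) that by blast
  show inv: "inverse x \<in> K" if "x \<in> K" for x
    using subfield_m_inv(1)[OF assms, of x] that sr(2) by (cases "x = 0") auto
  show "x - y \<in> K" if "x \<in> K" "y \<in> K" for x y
    using add[OF that(1) uminus[OF that(2)]] by simp
  show div: "x / y \<in> K" if "x \<in> K" "y \<in> K" for x y
    using mult[OF that(1) inv[OF that(2)]] by (simp add: divide_inverse)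
  have nat: "of_nat n \<in> K" for n
    by (induction n) (use sr(2) one add in auto)
  have int: "of_int i \<in> K" for i
    by (cases i rule: int_cases2) (use nat uminus in auto)
  obtain m n where "q = Rat.Fract m n" "n > 0" by (rule Rat_cases)
  then show "of_rat q \<in> K" using div[OF int int] by (simp add: of_rat_rat)
qed

lemma subfield_ambD_of_int: "subfield K amb \<Longrightarrow> of_int n \<in> K"
  using subfield_ambD(8)[of K "of_int n"] by simp

lemma subfield_rat_adjoin: "subfield (rat_adjoin S) amb"
  unfolding rat_adjoin_def
  by (rule field.generate_field_is_subfield[OF field_amb]) simp

lemma rat_adjoin_incl: "S \<subseteq> rat_adjoin S"
  unfolding rat_adjoin_def by (auto intro: generate_field.incl)

lemma rat_adjoin_minimal: "subfield K amb \<Longrightarrow> S \<subseteq> K \<Longrightarrow> rat_adjoin S \<subseteq> K"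
  unfolding rat_adjoin_def
  by (rule field.generate_field_min_subfield1[OF field_amb]) simp_all

text \<open>A nonzero algebraic x satisfies c + x q(x) = 0 with c nonzero, so 1/x = -q(x)/c is again
  a polynomial in x. This makes inverses automatic for every explicit set of expressions used
  below.\<close>

lemma algebraic_rat_algebra_subfield:
  fixes K :: "'a::field_char_0 set"
  assumes rat: "\<And>q. of_rat q \<in> K"
    and add: "\<And>x y. x \<in> K \<Longrightarrow> y \<in> K \<Longrightarrow> x + y \<in> K"
    and mult: "\<And>x y. x \<in> K \<Longrightarrow> y \<in> K \<Longrightarrow> x * y \<in> K"
    and alg: "\<And>x. x \<in> K \<Longrightarrow> algebraic x"
  shows "subfield K amb"
proof (rule subfield_ambI)
  show "1 \<in> K" using rat[of 1] by simp
  show uminus: "- x \<in> K" if "x \<in> K" for x using mult[OF rat[of "-1"] that] by simp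
  show "inverse x \<in> K" if x: "x \<in> K" for x
  proof (cases "x = 0")
    case False
    obtain p where p: "coeff p 0 \<noteq> 0" "poly (map_poly of_int p) x = 0"
      using algebraicE'_nonzero[OF alg[OF x] False] by metis
    have poly_in: "poly (map_poly of_int q) x \<in> K" for q
    proof (induction q)
      case 0
      show ?case using rat[of 0] by simp
    next
      case (pCons c q)
      show ?case using add[OF rat[of "of_int c"] mult[OF x pCons(2)]]
        by (simp add: map_poly_pCons)
    qed
    obtain c q where pq: "p = pCons c q" by (cases p)
    have "of_int c + x * poly (map_poly of_int q) x = 0" "c \<noteq> 0"
      using p unfolding pq by (simp_all add: map_poly_pCons)
    then have "inverse x = - (of_rat (1 / of_int c) * poly (map_poly of_int q) x)"
      using False by (simp add: of_rat_divide field_simps add_eq_0_iff)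
    then show ?thesis using uminus mult rat poly_in by metis
  qed (use rat[of 0] in simp)
qed (fact add mult)+

section \<open>Newton's identities\<close>

text \<open>Newton's identities are obtained from the logarithmic derivative of the product P of the
  factors 1 - x X: P' = -P A, where A is the generating function of the power sums. P is the
  reversal of the polynomial in question.\<close>

lemma power_sums_Rats_imp_coeff_Rats:
  fixes xs :: "'a::field_char_0 list"
  assumes "\<And>k. (\<Sum>x\<leftarrow>xs. x ^ Suc k) \<in> \<rat>"
  shows "coeff (\<Prod>x\<leftarrow>xs. [:- x, 1:]) n \<in> \<rat>"
proof -
  define P where "P = (\<Prod>x\<leftarrow>xs. 1 - fps_const x * fps_X)"
  define A where "A = Abs_fps (\<lambda>k. \<Sum>x\<leftarrow>xs. x ^ Suc k)"
  have geom: "(1 - fps_const x * fps_X) * Abs_fps (\<lambda>k. x ^ Suc k) = fps_const x" for x :: 'a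
    by (rule fps_ext) (auto simp: algebra_simps fps_X_mult_nth split: nat.splits, case_tac n, auto)
  have log_deriv: "fps_deriv P = - (P * A)"
    unfolding P_def A_def
  proof (induction xs)
    case (Cons x xs)
    define Q where "Q = (\<Prod>x\<leftarrow>xs. 1 - fps_const x * fps_X)"
    define G where "G = Abs_fps (\<lambda>k. x ^ Suc k)"
    define A' where "A' = Abs_fps (\<lambda>k. \<Sum>y\<leftarrow>xs. y ^ Suc k)"
    have sum: "Abs_fps (\<lambda>k. \<Sum>y\<leftarrow>x # xs. y ^ Suc k) = G + A'"
      by (rule fps_ext) (simp add: G_def A'_def)
    have "fps_deriv Q = - (Q * A')" using Cons unfolding Q_def A'_def .
    then have "fps_deriv ((1 - fps_const x * fps_X) * Q)
        = - (fps_const x * Q) - (1 - fps_const x * fps_X) * (Q * A')"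
      by (simp add: algebra_simps)
    also have "\<dots> = - ((1 - fps_const x * fps_X) * G * Q) - (1 - fps_const x * fps_X) * (Q * A')"
      unfolding G_def geom ..
    also have "\<dots> = - ((1 - fps_const x * fps_X) * Q * (G + A'))"
      by (simp add: algebra_simps)
    finally have "fps_deriv ((1 - fps_const x * fps_X) * Q) = - ((1 - fps_const x * fps_X) * Q * (G + A'))" .
    then show ?case unfolding sum Q_def by simp
  next
    case Nil
    show ?case by (simp add: fps_eq_iff)
  qed
  have P_Rats: "fps_nth P m \<in> \<rat>" for m
  proof (induction m rule: less_induct)
    case (less m)
    show ?case
    proof (cases m)
      case 0
      have "fps_nth P 0 = 1" unfolding P_def by (induction xs) auto
      then show ?thesis using 0 by simp
    next
      case (Suc k)
      \<comment> \<open>Only coefficients of P with index below m occur on the right, and m can be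
        divided out in characteristic 0.\<close>
      have "of_nat m * fps_nth P m = - (\<Sum>i=0..k. fps_nth P i * fps_nth A (k - i))"
        using arg_cong[OF log_deriv, of "\<lambda>F. fps_nth F k"] Suc by (simp add: fps_mult_nth)
      moreover have "\<dots> \<in> \<rat>"
        unfolding Rats_minus_iff A_def fps_nth_Abs_fps
        by (intro Rats_sum Rats_mult assms less) (simp add: Suc)
      ultimately have "of_nat m * fps_nth P m / of_nat m \<in> \<rat>" by (intro Rats_divide) simp_all
      then show ?thesis using Suc by (simp del: of_nat_Suc)
    qed
  qed
  define p where "p = (\<Prod>x\<leftarrow>xs. [:- x, 1:])"
  \<comment> \<open>For x = 0 the reversed polynomial drops to degree 0, but both sides are still
    equal, namely 1.\<close>
  have linear: "fps_of_poly (reflect_poly [:- x, 1:]) = 1 - fps_const x * fps_X" for x :: 'a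
    by (rule fps_ext) (auto simp: coeff_reflect_poly coeff_pCons split: nat.splits)
  have "P = fps_of_poly (reflect_poly p)"
    unfolding P_def p_def
    by (induction xs) (simp_all only: list.map prod_list.Nil prod_list.Cons reflect_poly_mult
        fps_of_poly_mult linear reflect_poly_1 fps_of_poly_1)
  then have reflect: "coeff (reflect_poly p) m \<in> \<rat>" for m
    using P_Rats[of m] by simp
  show ?thesis
  proof (cases "n \<le> degree p")
    case True
    then show ?thesis using reflect[of "degree p - n"] by (auto simp: coeff_reflect_poly simp flip: p_def split: if_splits)
  qed (simp add: coeff_eq_0 flip: p_def)
qed

section \<open>Rational polynomials and their common roots\<close>

lemma poly_of_rat_add:
  "poly (map_poly of_rat (p + q)) (x::'a::field_char_0) = poly (map_poly of_rat p) x + poly (map_poly of_rat q) x"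
  by (simp add: map_poly_def flip: poly_add)
     (metis (no_types, lifting) coeff_add coeff_map_poly map_poly_def of_rat_add poly_eqI poly_add of_rat_0)

lemma poly_of_rat_mult:
  "poly (map_poly of_rat (p * q)) (x::'a::field_char_0) = poly (map_poly of_rat p) x * poly (map_poly of_rat q) x"
proof (induction p)
  case (pCons c p)
  have "map_poly of_rat (smult c q) = (smult (of_rat c) (map_poly of_rat q) :: 'a poly)"
    by (rule map_poly_smult) (simp_all add: of_rat_mult)
  with pCons show ?case
    by (simp add: poly_of_rat_add map_poly_pCons algebra_simps)
qed simp

text \<open>If p did not divide c, a Bezout identity r p + s c = 1 evaluated at the common root x
  would give 0 = 1. This replaces the existence of an automorphism taking x to y.\<close>

lemma irreducible_root_transfer:
  fixes x y :: "'a::field_char_0"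
  assumes "irreducible p" "poly (map_poly of_rat p) x = 0" "poly (map_poly of_rat c) x = 0"
    "poly (map_poly of_rat p) y = 0"
  shows "poly (map_poly of_rat c) y = 0"
proof (cases "p dvd c")
  case True
  then show ?thesis using assms(4) by (auto simp: poly_of_rat_mult elim!: dvdE)
next
  case False
  then have "coprime p c"
    using assms(1) by (intro prime_elem_imp_coprime irreducible_imp_prime_elem)
  then obtain r s where "r * p + s * c = 1"
    by (metis bezout_coefficients_fst_snd coprime_iff_gcd_eq_1)
  then have "poly (map_poly of_rat (r * p + s * c)) x = 1" by simp
  then show ?thesis using assms by (simp add: poly_of_rat_add poly_of_rat_mult)
qed

section \<open>Group algebra elements, integral bases and the index\<close>

lemma lookup_cscale: "Poly_Mapping.lookup (cscale c h) k = c * Poly_Mapping.lookup h k"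
  by (simp add: cscale_def Poly_Mapping.map.rep_eq when_def)

lemma lookup_sum: "Poly_Mapping.lookup (sum f A) k = (\<Sum>x\<in>A. Poly_Mapping.lookup (f x) k)"
  by (induction A rule: infinite_finite_induct) (simp_all add: lookup_add)

lemma cscale_single: "cscale c (Poly_Mapping.single j d) = Poly_Mapping.single j (c * d)"
  by (rule poly_mapping_eqI) (simp add: lookup_cscale lookup_single when_def)

lemma cscale_add: "cscale c (h + h') = cscale c h + cscale c h'"
  by (rule poly_mapping_eqI) (simp add: lookup_cscale lookup_add algebra_simps)

text \<open>Passes from the set of entries to the indexed family, so that relations and spans become
  sums over indices. Injectivity follows from independence of the family, since two equal entries
  satisfy the relation with coefficients 1 and -1.\<close>

lemma is_int_basis_iff:
  fixes v :: "('g \<Rightarrow>\<^sub>0 'a::field_char_0) ^ 'n"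
  shows "is_int_basis A v \<longleftrightarrow>
    (\<forall>c. (\<Sum>i\<in>UNIV. zscale (c i) (v $ i)) = 0 \<longrightarrow> (\<forall>i. c i = 0)) \<and>
    A = range (\<lambda>c. \<Sum>i\<in>UNIV. zscale (c i) (v $ i))" (is "_ \<longleftrightarrow> ?indep \<and> ?span")
proof -
  interpret zm: Modules.module "zscale :: int \<Rightarrow> ('g \<Rightarrow>\<^sub>0 'a) \<Rightarrow> _" by (rule module_zscale)
  have key: "zm.independent (range (\<lambda>i. v $ i)) = ?indep \<and> (zm.span (range (\<lambda>i. v $ i)) = A) = ?span"
    if inj: "inj (\<lambda>i. v $ i)"
  proof -
    let ?S = "range (\<lambda>i. v $ i)"
    have fin: "finite ?S" by simp
    have reindex: "(\<Sum>x\<in>?S. zscale (u x) x) = (\<Sum>i\<in>UNIV. zscale (u (v $ i)) (v $ i))" for u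
      by (rule sum.reindex_cong[OF inj refl refl])
    define inv_v where "inv_v = inv_into UNIV (\<lambda>i. v $ i)"
    have inv_v: "inv_v (v $ i) = i" for i
      unfolding inv_v_def by (rule inv_f_f[OF inj])
    have indep: "zm.independent ?S = ?indep"
    proof
      assume ind: "zm.independent ?S"
      show ?indep
      proof (intro allI impI)
        fix c i assume "(\<Sum>i\<in>UNIV. zscale (c i) (v $ i)) = 0"
        then have "(\<Sum>x\<in>?S. zscale (c (inv_v x)) x) = 0" unfolding reindex inv_v .
        from zm.independentD[OF ind fin order_refl this, of "v $ i"] show "c i = 0" unfolding inv_v by blast
      qed
    next
      assume ind: ?indep
      show "zm.independent ?S"
      proof
        assume "zm.dependent ?S"
        then obtain u where u: "\<exists>x\<in>?S. u x \<noteq> 0" "(\<Sum>x\<in>?S. zscale (u x) x) = 0"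
          unfolding zm.dependent_finite[OF fin] by blast
        have "\<forall>i. u (v $ i) = 0"
          using ind[THEN spec, of "\<lambda>i. u (v $ i)"] u(2) unfolding reindex by (rule mp)
        with u(1) show False by blast
      qed
    qed
    have "zm.span ?S = range (\<lambda>c. \<Sum>i\<in>UNIV. zscale (c i) (v $ i))"
      unfolding zm.span_finite[OF fin] reindex
    proof (intro equalityI image_subsetI)
      fix c :: "'n \<Rightarrow> int"
      have "(\<Sum>i\<in>UNIV. zscale (c i) (v $ i)) = (\<Sum>i\<in>UNIV. zscale ((\<lambda>x. c (inv_v x)) (v $ i)) (v $ i))"
        unfolding inv_v ..
      then show "(\<Sum>i\<in>UNIV. zscale (c i) (v $ i)) \<in> range (\<lambda>u. \<Sum>i\<in>UNIV. zscale (u (v $ i)) (v $ i))"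
        by (rule range_eqI[where x = "\<lambda>x. c (inv_v x)"])
    next
      fix u :: "('g \<Rightarrow>\<^sub>0 'a) \<Rightarrow> int"
      show "(\<Sum>i\<in>UNIV. zscale (u (v $ i)) (v $ i)) \<in> range (\<lambda>c. \<Sum>i\<in>UNIV. zscale (c i) (v $ i))"
        by (rule range_eqI[of _ _ "\<lambda>i. u (v $ i)"]) (rule refl)
    qed
    then show ?thesis using indep by auto
  qed
  have "inj (\<lambda>i. v $ i)" if ?indep
  proof (rule injI, rule ccontr)
    fix i j assume ij: "v $ i = v $ j" "i \<noteq> j"
    let ?c = "\<lambda>k. if k = i then 1 else if k = j then - 1 else 0"
    have "(\<Sum>k\<in>UNIV. zscale (?c k) (v $ k)) = (\<Sum>k\<in>{i, j}. zscale (?c k) (v $ k))"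
      by (rule sum.mono_neutral_right) auto
    also have "\<dots> = 0" using ij by simp
    finally show False using that[THEN spec, of ?c, THEN mp, THEN spec, of i] by simp
  qed
  then show ?thesis unfolding is_int_basis_def using key by blast
qed

section \<open>Change of basis and well-definedness of the index\<close>

text \<open>Multiplying a rational relation by the product d of all denominators makes it
  integral.\<close>

lemma int_independent_imp_rat_independent:
  fixes v :: "('g \<Rightarrow>\<^sub>0 'a::field_char_0) ^ 'n" and q :: "'n \<Rightarrow> rat"
  assumes indep: "\<And>c. (\<Sum>i\<in>UNIV. zscale (c i) (v $ i)) = 0 \<Longrightarrow> \<forall>i. c i = 0"
    and zero: "(\<Sum>i\<in>UNIV. cscale (of_rat (q i)) (v $ i)) = 0"
  shows "q i = 0"
proof -
  define den where "den i = snd (quotient_of (q i))" for i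
  define d where "d = (\<Prod>i\<in>UNIV. den i)"
  have den: "den i > 0" "of_int (den i) * q i = of_int (fst (quotient_of (q i)))" for i
  proof -
    show pos: "den i > 0" using quotient_of_denom_pos'[of "q i"] by (simp add: den_def)
    have "q i = of_int (fst (quotient_of (q i))) / of_int (den i)"
      using quotient_of_div[of "q i"] by (simp add: den_def prod_eq_iff)
    then show "of_int (den i) * q i = of_int (fst (quotient_of (q i)))"
      using pos by (simp add: field_simps)
  qed
  have d: "d \<noteq> 0" using den(1) unfolding d_def by (metis finite less_irrefl prod_zero_iff)
  have "\<exists>n. of_int d * q i = of_int n" for i
  proof -
    have "d = den i * (\<Prod>j\<in>UNIV - {i}. den j)" unfolding d_def by (rule prod.remove) simp_all
    then have "of_int d * q i = of_int (fst (quotient_of (q i)) * (\<Prod>j\<in>UNIV - {i}. den j))"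
      using den(2)[of i] by (simp add: mult_ac)
    then show ?thesis by blast
  qed
  then obtain n where n: "\<And>i. of_int d * q i = of_int (n i)" by metis
  have "zscale (n i) (v $ i) = cscale (of_int d) (cscale (of_rat (q i)) (v $ i))" for i
  proof (rule poly_mapping_eqI)
    fix k
    have "of_int (n i) = (of_int d * of_rat (q i) :: 'a)"
      by (metis n of_rat_mult of_rat_of_int_eq)
    then show "Poly_Mapping.lookup (zscale (n i) (v $ i)) k
        = Poly_Mapping.lookup (cscale (of_int d) (cscale (of_rat (q i)) (v $ i))) k"
      by (simp add: lookup_zscale lookup_cscale)
  qed
  then have "(\<Sum>i\<in>UNIV. zscale (n i) (v $ i)) = cscale (of_int d) (\<Sum>i\<in>UNIV. cscale (of_rat (q i)) (v $ i))"
    by (intro poly_mapping_eqI) (simp add: lookup_sum lookup_cscale sum_distrib_left)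
  also have "\<dots> = 0" unfolding zero by (intro poly_mapping_eqI) (simp add: lookup_cscale)
  finally have "n i = 0" using indep by blast
  then show "q i = 0" using n[of i] d by simp
qed

text \<open>Column j holds the coordinates of entry j, which is why the factors compose in the order
  \<open>Q ** P\<close>.\<close>

lemma rat_combination_matrix_mult:
  fixes u v w :: "('g \<Rightarrow>\<^sub>0 'a::field_char_0) ^ 'n" and P Q :: "rat ^ 'n ^ 'n"
  assumes "\<And>j. w $ j = (\<Sum>i\<in>UNIV. cscale (of_rat (P $ i $ j)) (v $ i))"
    "\<And>j. v $ j = (\<Sum>i\<in>UNIV. cscale (of_rat (Q $ i $ j)) (u $ i))"
  shows "w $ j = (\<Sum>i\<in>UNIV. cscale (of_rat ((Q ** P) $ i $ j)) (u $ i))"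
proof (rule poly_mapping_eqI)
  fix k
  have "Poly_Mapping.lookup (w $ j) k
      = (\<Sum>i\<in>UNIV. \<Sum>l\<in>UNIV. of_rat (P $ i $ j) * (of_rat (Q $ l $ i) * Poly_Mapping.lookup (u $ l) k))"
    by (simp add: assms(1) assms(2)[of "_ :: 'n"] lookup_sum lookup_cscale sum_distrib_left)
  also have "\<dots> = (\<Sum>l\<in>UNIV. \<Sum>i\<in>UNIV. of_rat (P $ i $ j) * (of_rat (Q $ l $ i) * Poly_Mapping.lookup (u $ l) k))"
    by (rule sum.swap)
  also have "\<dots> = Poly_Mapping.lookup (\<Sum>i\<in>UNIV. cscale (of_rat ((Q ** P) $ i $ j)) (u $ i)) k"
    by (simp add: lookup_sum lookup_cscale matrix_matrix_mult_def of_rat_sum of_rat_mult sum_distrib_left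
        sum_distrib_right mult_ac)
  finally show "Poly_Mapping.lookup (w $ j) k
      = Poly_Mapping.lookup (\<Sum>i\<in>UNIV. cscale (of_rat ((Q ** P) $ i $ j)) (u $ i)) k" .
qed

lemma is_int_basis_matrix_unique:
  fixes v w :: "('g \<Rightarrow>\<^sub>0 'a::field_char_0) ^ 'n" and P Q :: "rat ^ 'n ^ 'n"
  assumes "is_int_basis A v"
    and P: "\<And>j. w $ j = (\<Sum>i\<in>UNIV. cscale (of_rat (P $ i $ j)) (v $ i))"
    and Q: "\<And>j. w $ j = (\<Sum>i\<in>UNIV. cscale (of_rat (Q $ i $ j)) (v $ i))"
  shows "P = Q"
proof -
  have "P $ i $ j - Q $ i $ j = 0" for i j
  proof (rule int_independent_imp_rat_independent[of v "\<lambda>i. P $ i $ j - Q $ i $ j"])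
    show "(\<Sum>i\<in>UNIV. cscale (of_rat (P $ i $ j - Q $ i $ j)) (v $ i)) = 0"
    proof (rule poly_mapping_eqI)
      fix k
      show "Poly_Mapping.lookup (\<Sum>i\<in>UNIV. cscale (of_rat (P $ i $ j - Q $ i $ j)) (v $ i)) k
          = Poly_Mapping.lookup 0 k"
        using arg_cong[OF P[of j, unfolded Q[of j]], of "\<lambda>h. Poly_Mapping.lookup h k"]
        by (simp add: lookup_sum lookup_cscale of_rat_diff left_diff_distrib sum_subtractf)
    qed
  qed (use assms(1) in \<open>auto simp: is_int_basis_iff\<close>)
  then show ?thesis by (simp add: vec_eq_iff)
qed

lemma is_int_basis_change:
  fixes v v' :: "('g \<Rightarrow>\<^sub>0 'a::field_char_0) ^ 'n"
  assumes "is_int_basis A v" "is_int_basis A v'"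
  obtains U :: "rat ^ 'n ^ 'n" where "\<And>i j. U $ i $ j \<in> \<int>"
    "\<And>j. v' $ j = (\<Sum>i\<in>UNIV. cscale (of_rat (U $ i $ j)) (v $ i))"
proof -
  have "v' $ j \<in> A" for j
  proof -
    let ?c = "\<lambda>k. if k = j then 1 else 0"
    have "(\<Sum>k\<in>UNIV. zscale (?c k) (v' $ k)) = v' $ j"
      by (rule poly_mapping_eqI) (simp add: lookup_sum lookup_zscale if_distrib[of of_int] if_distrib[of "\<lambda>x. x * _"] cong: if_cong)
    moreover have "A = range (\<lambda>c. \<Sum>i\<in>UNIV. zscale (c i) (v' $ i))"
      using assms(2) by (simp only: is_int_basis_iff)
    ultimately show ?thesis using rangeI[of "\<lambda>c. \<Sum>i\<in>UNIV. zscale (c i) (v' $ i)" ?c] by simp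
  qed
  then have "\<exists>c. v' $ j = (\<Sum>i\<in>UNIV. zscale (c i) (v $ i))" for j
    using assms(1) unfolding is_int_basis_iff by blast
  then obtain c where "\<And>j. v' $ j = (\<Sum>i\<in>UNIV. zscale (c j i) (v $ i))" by metis
  then show ?thesis by (intro that[of "\<chi> i j. of_int (c j i)"]) (simp_all add: zscale_def)
qed

text \<open>The description in \<open>gen_index\<close> has a value because the transition matrices
  between two bases are integral and mutually inverse, so their determinants are integers with
  product 1. One explicit basis therefore suffices to compute the index.\<close>

lemma gen_index_eqI:
  fixes v w :: "('g \<Rightarrow>\<^sub>0 'a::field_char_0) ^ 'n" and P :: "rat ^ 'n ^ 'n"
  assumes v: "is_int_basis A v"
    and P: "\<And>j. w $ j = (\<Sum>i\<in>UNIV. cscale (of_rat (P $ i $ j)) (v $ i))"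
  shows "gen_index A w = \<bar>det P\<bar>"
  unfolding gen_index_def
proof (rule the_equality)
  fix d
  assume "\<exists>(v :: ('g \<Rightarrow>\<^sub>0 'a) ^ 'n) (P :: rat ^ 'n ^ 'n). is_int_basis A v \<and>
     (\<forall>j. w $ j = (\<Sum>i\<in>UNIV. cscale (of_rat (P $ i $ j)) (v $ i))) \<and> d = \<bar>det P\<bar>"
  then obtain v' and P' :: "rat ^ 'n ^ 'n" where v': "is_int_basis A v'"
    and P': "\<And>j. w $ j = (\<Sum>i\<in>UNIV. cscale (of_rat (P' $ i $ j)) (v' $ i))" and d: "d = \<bar>det P'\<bar>"
    by blast
  obtain U :: "rat ^ 'n ^ 'n" where U: "\<And>i j. U $ i $ j \<in> \<int>" "\<And>j. v' $ j = (\<Sum>i\<in>UNIV. cscale (of_rat (U $ i $ j)) (v $ i))"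
    using is_int_basis_change[OF v v'] by blast
  obtain U' :: "rat ^ 'n ^ 'n" where U': "\<And>i j. U' $ i $ j \<in> \<int>" "\<And>j. v $ j = (\<Sum>i\<in>UNIV. cscale (of_rat (U' $ i $ j)) (v' $ i))"
    using is_int_basis_change[OF v' v] by blast
  have "v $ j = (\<Sum>i\<in>UNIV. cscale (of_rat ((mat 1 :: rat ^ 'n ^ 'n) $ i $ j)) (v $ i))" for j
    by (rule poly_mapping_eqI)
       (simp add: lookup_sum lookup_cscale mat_def if_distrib[of of_rat] if_distrib[of "\<lambda>x. x * _"] cong: if_cong)
  then have "U ** U' = mat 1"
    by (rule is_int_basis_matrix_unique[OF v rat_combination_matrix_mult[OF U'(2) U(2)]])
  then have "det U * det U' = 1" by (metis det_I det_mul)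
  moreover have Ints_det: "det V \<in> \<int>" if "\<And>i j. V $ i $ j \<in> \<int>" for V :: "rat ^ 'n ^ 'n"
    unfolding det_def using that by (intro Ints_sum Ints_mult Ints_prod) simp_all
  then obtain m n where "det U = of_int m" "det U' = of_int n"
    using U(1) U'(1) by (metis Ints_cases)
  ultimately have "\<bar>det U\<bar> = 1"
    by (metis abs_zmult_eq_1 of_int_1 of_int_abs of_int_eq_iff of_int_mult abs_one)
  \<comment> \<open>Both matrices express \<open>w\<close> in the basis \<open>v\<close>, one
    directly and one by way of \<open>v'\<close>.\<close>
  moreover have "P = U ** P'"
    by (rule is_int_basis_matrix_unique[OF v P rat_combination_matrix_mult[OF P' U(2)]])
  ultimately show "d = \<bar>det P\<bar>" by (simp add: d det_mul abs_mult)
qed (use v P in blast)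

section \<open>Galois groups\<close>

lemma Gal_iff:
  "s \<in> carrier (Gal E K) \<longleftrightarrow> s \<in> Bij E \<and> (\<forall>x\<in>E. \<forall>y\<in>E. s (x + y) = s x + s y \<and> s (x * y) = s x * s y) \<and>
     s 1 = 1 \<and> (\<forall>x\<in>K. s x = x)"
  using Bij_imp_funcset[of s E] by (auto simp: Gal_def ring_hom_def)

text \<open>\<open>BijGroup E\<close> supplies the group laws, so only closure has to be checked.
  The inverse of a bijection respects every operation that the bijection respects.\<close>

lemma group_Gal:
  assumes "subfield E amb" "K \<subseteq> E"
  shows "group (Gal E K)"
proof -
  interpret B: group "BijGroup E" by (rule group_BijGroup)
  note E = subfield_ambD[OF assms(1)]
  have "subgroup (carrier (Gal E K)) (BijGroup E)"
  proof
    show sub: "carrier (Gal E K) \<subseteq> carrier (BijGroup E)" by (auto simp: Gal_iff BijGroup_def)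
    show "\<one>\<^bsub>BijGroup E\<^esub> \<in> carrier (Gal E K)"
      using E assms(2) by (auto simp: Gal_iff BijGroup_def id_Bij)
    fix s assume s: "s \<in> carrier (Gal E K)"
    then have sB: "s \<in> Bij E" and s_hom: "\<And>x y. x \<in> E \<Longrightarrow> y \<in> E \<Longrightarrow> s (x + y) = s x + s y"
      "\<And>x y. x \<in> E \<Longrightarrow> y \<in> E \<Longrightarrow> s (x * y) = s x * s y" and s1: "s 1 = 1"
      and s_fix: "\<And>x. x \<in> K \<Longrightarrow> s x = x" by (auto simp: Gal_iff)
    have inj: "inj_on s E" using sB by (simp add: Bij_def bij_betw_def)
    show "s \<otimes>\<^bsub>BijGroup E\<^esub> t \<in> carrier (Gal E K)" if t: "t \<in> carrier (Gal E K)" for t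
    proof -
      have tB: "t \<in> Bij E" using t by (simp add: Gal_iff)
      then have t_E: "t x \<in> E" if "x \<in> E" for x using Bij_imp_funcset that by blast
      show ?thesis using compose_Bij[OF sB tB, unfolded compose_def] t tB sB t_E s_hom s1 s_fix E(1,2,4) assms(2)
        by (auto simp: Gal_iff BijGroup_def compose_def)
    qed
    have inv: "inv\<^bsub>BijGroup E\<^esub> s = (\<lambda>x\<in>E. inv_into E s x)" by (rule inv_BijGroup[OF sB])
    have inv_fix: "inv_into E s x = x" if "x \<in> E" "s x = x" for x
      using inv_into_f_f[OF inj that(1)] that(2) by simp
    show "inv\<^bsub>BijGroup E\<^esub> s \<in> carrier (Gal E K)"
      unfolding Gal_iff inv
    proof (intro conjI ballI)
      show "(\<lambda>x\<in>E. inv_into E s x) \<in> Bij E" by (rule restrict_inv_into_Bij[OF sB])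
      show "(\<lambda>x\<in>E. inv_into E s x) (x + y) = (\<lambda>x\<in>E. inv_into E s x) x + (\<lambda>x\<in>E. inv_into E s x) y"
        "(\<lambda>x\<in>E. inv_into E s x) (x * y) = (\<lambda>x\<in>E. inv_into E s x) x * (\<lambda>x\<in>E. inv_into E s x) y"
        if "x \<in> E" "y \<in> E" for x y
        using that E Bij_inv_into_lemma[of E s "(+)" x y] Bij_inv_into_lemma[of E s "(*)" x y] s_hom sB
        by (auto simp: Pi_iff)
      show "(\<lambda>x\<in>E. inv_into E s x) 1 = 1" using inv_fix[OF E(1) s1] E(1) by simp
      show "(\<lambda>x\<in>E. inv_into E s x) x = x" if "x \<in> K" for x
        using inv_fix s_fix that assms(2) by auto
    qed
  qed
  then have "group ((BijGroup E)\<lparr>carrier := carrier (Gal E K)\<rparr>)"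
    by (rule B.subgroup_imp_group)
  then show ?thesis by (simp add: Gal_def)
qed

lemma Gal_mult_apply:
  assumes "s \<in> carrier (Gal E K)" "t \<in> carrier (Gal E K)" "x \<in> E"
  shows "(s \<otimes>\<^bsub>Gal E K\<^esub> t) x = s (t x)"
  using assms by (simp add: Gal_def BijGroup_def compose_def)

lemma Gal_one_apply: "x \<in> E \<Longrightarrow> \<one>\<^bsub>Gal E K\<^esub> x = x"
  by (simp add: Gal_def BijGroup_def)

lemma Gal_mono: "K \<subseteq> K' \<Longrightarrow> carrier (Gal E K') \<subseteq> carrier (Gal E K)"
  by (auto simp: Gal_iff subset_iff)

section \<open>Arithmetic of the lattice\<close>

text \<open>By Bezout, q is an integral combination of m q and n q.\<close>

lemma coprime_Ints_mult:
  fixes q :: rat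
  assumes "coprime m n" "of_int m * q \<in> \<int>" "of_int n * q \<in> \<int>"
  shows "q \<in> \<int>"
proof -
  obtain u v where "u * m + v * n = 1"
    using assms(1) by (metis bezout_int coprime_iff_gcd_eq_1)
  then have "of_int (u * m + v * n) * q = q" by simp
  then have "q = of_int u * (of_int m * q) + of_int v * (of_int n * q)"
    by (simp add: algebra_simps)
  also have "\<dots> \<in> \<int>" by (intro Ints_add Ints_mult[OF Ints_of_int] assms)
  finally show ?thesis .
qed

text \<open>Up to the sign of y, the forms are the coordinates of h 1, h \<alpha> and h \<alpha>^2
  with respect to 1, \<alpha>, \<alpha>^2, for h = x w_1 + y w_2 + t w_3; the two coordinates of h 1
  that vanish are omitted. Each denominator is bounded by exhibiting two coprime multiples that are
  integral.\<close>

lemma lattice_iff: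
  fixes a b g :: int and x y t :: rat
  assumes g: "g = gcd a b" and not3: "\<not> 3 dvd a"
  shows "(x + 2 * t \<in> \<int> \<and> x - t + 9 * of_int b * y \<in> \<int> \<and> - 4 * of_int a ^ 2 * y \<in> \<int> \<and> 6 * of_int a * y \<in> \<int> \<and>
      2 * of_int a * t + 6 * of_int a * of_int b * y \<in> \<int> \<and> - 2 * of_int a ^ 2 * y \<in> \<int> \<and>
      x - t - 9 * of_int b * y \<in> \<int>) \<longleftrightarrow>
    (\<exists>k m n. x = of_int k \<and> y = of_int m / (2 * of_int g) \<and> t = of_int n / 2 \<and> even (n - b div g * m))"
    (is "?L \<longleftrightarrow> ?R")
proof -
  have a0: "a \<noteq> 0" using not3 by auto
  then have g0: "g \<noteq> 0" using g by simp
  define a' b' where "a' = a div g" and "b' = b div g"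
  have ab: "a = g * a'" "b = g * b'" by (simp_all add: a'_def b'_def g)
  have cop: "coprime 3 a" using not3 by (simp add: prime_imp_coprime)
  have cop': "coprime a' (9 * b')"
  proof -
    have "coprime a' b'" unfolding a'_def b'_def g using a0 by (simp add: div_gcd_coprime)
    moreover have "coprime a' 3" using cop unfolding ab by (simp add: coprime_commute)
    then have "coprime a' (3 * 3)" unfolding coprime_mult_right_iff by simp
    then have "coprime a' 9" by simp
    ultimately show ?thesis by simp
  qed
  show ?thesis
  proof
    assume L: ?L
    then have L1: "x + 2 * t \<in> \<int>" and L2: "x - t + 9 * of_int b * y \<in> \<int>"
      and L3: "2 * of_int a * t + 6 * of_int a * of_int b * y \<in> \<int>" and L4: "x - t - 9 * of_int b * y \<in> \<int>"
      by blast+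
    \<comment> \<open>The two multiples are 3 (2 a y) = 6 a y and a (2 a y) = 2 a^2 y.\<close>
    have 1: "2 * of_int a * y \<in> \<int>"
      by (rule coprime_Ints_mult[OF cop]) (use L in \<open>auto simp: mult_ac power2_eq_square\<close>)
    \<comment> \<open>The difference is 18 b y = 9 b' (2 g y), whereas 2 a y = a' (2 g y), and a' is
      coprime to 9 b'.\<close>
    have "(x - t + 9 * of_int b * y) - (x - t - 9 * of_int b * y) \<in> \<int>" by (rule Ints_diff[OF L2 L4])
    then have 2: "of_int (9 * b') * (2 * of_int g * y) \<in> \<int>" by (simp add: ab mult_ac)
    have "2 * of_int g * y \<in> \<int>"
      by (rule coprime_Ints_mult[OF cop']) (use 1 2 in \<open>simp_all add: ab mult_ac\<close>)
    then obtain m where m: "2 * of_int g * y = of_int m" by (rule Ints_cases)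
    then have y: "y = of_int m / (2 * of_int g)" using g0 by (simp add: field_simps)
    have b_y: "of_int b * y = of_int (b' * m) / 2" using g0 by (simp add: y ab)
    \<comment> \<open>The summand 9 b' m equals 18 b y and cancels the y part, leaving 3 (2 t). The
      next block isolates a (2 t) in the same way.\<close>
    have "2 * ((x + 2 * t) - (x - t + 9 * of_int b * y)) + of_int (9 * b' * m) \<in> \<int>"
      by (intro Ints_add[OF Ints_mult[OF _ Ints_diff[OF L1 L2]]]) simp_all
    also have "2 * ((x + 2 * t) - (x - t + 9 * of_int b * y)) + of_int (9 * b' * m) = of_int 3 * (2 * t)"
      by (simp add: mult.assoc b_y)
    finally have 3: "of_int 3 * (2 * t) \<in> \<int>" .
    have "(2 * of_int a * t + 6 * of_int a * of_int b * y) - of_int (3 * a * b' * m) \<in> \<int>"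
      by (intro Ints_diff[OF L3]) simp
    also have "(2 * of_int a * t + 6 * of_int a * of_int b * y) - of_int (3 * a * b' * m) = of_int a * (2 * t)"
      by (simp add: mult.assoc b_y)
    finally have "2 * t \<in> \<int>" by (rule coprime_Ints_mult[OF cop 3])
    then obtain n where n: "2 * t = of_int n" by (rule Ints_cases)
    then have t: "t = of_int n / 2" by simp
    have "(x + 2 * t) - of_int n \<in> \<int>" by (intro Ints_diff[OF L1]) simp
    then obtain k where k: "x = of_int k" unfolding n by (auto elim: Ints_cases)
    obtain l where "(x + 2 * t) - (x - t + 9 * of_int b * y) = of_int l"
      using Ints_diff[OF L1 L2] by (rule Ints_cases)
    then have "3 * (2 * t) - 18 * (of_int b * y) = 2 * of_int l"
      by (simp add: algebra_simps)
    \<comment> \<open>Since 3 and 9 are odd, this congruence modulo 2 says that n and b' m have the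
      same parity.\<close>
    then have "of_int (3 * n - 9 * (b' * m)) = (of_int (2 * l) :: rat)"
      unfolding n b_y by simp
    then have "3 * n - 9 * (b' * m) = 2 * l" by (simp only: of_int_eq_iff)
    then have "even (n - b' * m)" by presburger
    then show ?R using k y t unfolding b'_def by blast
  next
    assume ?R
    then obtain k m n where kmn: "x = of_int k" "y = of_int m / (2 * of_int g)" "t = of_int n / 2" "even (n - b' * m)"
      unfolding b'_def by blast
    from kmn(4) obtain l where l: "n = b' * m + 2 * l" by (metis evenE diff_eq_eq add.commute)
    have a_y: "of_int a * y = of_int (a' * m) / 2" and b_y: "of_int b * y = of_int (b' * m) / 2"
      using g0 by (simp_all add: kmn ab)
    \<comment> \<open>The numbers a y and b y are half-integers. After substituting for t, every
      form contains them only with even integral coefficients.\<close>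
    have t: "t = of_int b * y + of_int l" unfolding b_y by (simp add: kmn(3) l add_divide_distrib)
    have am: "of_int (a' * m) = 2 * (of_int a * y)" and bm: "of_int (b' * m) = 2 * (of_int b * y)"
      using a_y b_y by simp_all
    have eqs: "x + 2 * t = of_int k + of_int (b' * m) + 2 * of_int l"
      "x - t + 9 * of_int b * y = of_int k - of_int l + 4 * of_int (b' * m)"
      "- 4 * of_int a ^ 2 * y = - 2 * of_int a * of_int (a' * m)" "6 * of_int a * y = 3 * of_int (a' * m)"
      "2 * of_int a * t + 6 * of_int a * of_int b * y = 4 * of_int a * of_int (b' * m) + 2 * of_int a * of_int l"
      "- 2 * of_int a ^ 2 * y = - of_int a * of_int (a' * m)"
      "x - t - 9 * of_int b * y = of_int k - of_int l - 5 * of_int (b' * m)"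
      unfolding am bm t kmn(1) by (simp_all add: power2_eq_square algebra_simps)
    show ?L unfolding eqs by simp
  qed
qed

text \<open>After division by the gcd the two quotients are not both even, so b / g is odd exactly
  when b carries no more factors 2 than a.\<close>

lemma odd_div_gcd_iff:
  fixes a b :: int
  assumes "a \<noteq> 0"
  shows "odd (b div gcd a b) \<longleftrightarrow> vp 2 a \<ge> vp 2 b"
proof (cases "b = 0")
  case True
  then show ?thesis using assms by (simp add: vp_def)
next
  case False
  define g a' b' where "g = gcd a b" and "a' = a div g" and "b' = b div g"
  have g0: "g \<noteq> 0" using assms by (simp add: g_def)
  have ab: "a = g * a'" "b = g * b'" by (simp_all add: a'_def b'_def g_def)
  then have nz: "a' \<noteq> 0" "b' \<noteq> 0" using assms False by auto
  have cop: "coprime a' b'" unfolding a'_def b'_def g_def using assms by (simp add: div_gcd_coprime)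
  have even_iff: "even c \<longleftrightarrow> multiplicity 2 c > 0" if "c \<noteq> 0" for c :: int
    using that multiplicity_gt_zero_iff[of c 2] by simp
  have "multiplicity 2 a = multiplicity 2 g + multiplicity 2 a'" "multiplicity 2 b = multiplicity 2 g + multiplicity 2 b'"
    unfolding ab using g0 nz by (simp_all add: prime_elem_multiplicity_mult_distrib)
  moreover have "\<not> (even a' \<and> even b')" using cop by (meson coprime_common_divisor odd_one)
  ultimately have "odd b' \<longleftrightarrow> multiplicity 2 b \<le> multiplicity 2 a"
    using even_iff[OF nz(1)] even_iff[OF nz(2)] by auto
  then show ?thesis using assms False by (simp add: vp_def b'_def g_def)
qed

section \<open>Expressions in a root and a square root of the discriminant\<close>

text \<open>
  These predicates are about functions and not about elements of the field, so that the values
  \<open>u \<alpha>\<^sub>i\<close> and \<open>F \<alpha>\<^sub>i (\<plusminus> z)\<close> are simultaneous conjugates that are available without constructing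
  any automorphism.
\<close>

definition quad_on_roots :: "int \<Rightarrow> int \<Rightarrow> ('a::field_char_0 \<Rightarrow> 'a) \<Rightarrow> bool" where
  "quad_on_roots a b u \<longleftrightarrow> (\<exists>c0 c1 c2. \<forall>x. x ^ 3 - of_int a * x + of_int b = 0 \<longrightarrow>
     u x = of_rat c0 + of_rat c1 * x + of_rat c2 * x ^ 2)"

lemma quad_on_roots_const: "quad_on_roots a b (\<lambda>_. of_rat q)"
  unfolding quad_on_roots_def by (rule exI[of _ q], rule exI[of _ 0], rule exI[of _ 0]) simp

lemma quad_on_roots_id: "quad_on_roots a b (\<lambda>x. x)"
  unfolding quad_on_roots_def by (rule exI[of _ 0], rule exI[of _ 1], rule exI[of _ 0]) simp

lemma quad_on_roots_add:
  assumes "quad_on_roots a b u" "quad_on_roots a b v"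
  shows "quad_on_roots a b (\<lambda>x. u x + v x)"
proof -
  obtain c0 c1 c2 d0 d1 d2 where
    "x ^ 3 - of_int a * x + of_int b = 0 \<Longrightarrow> u x = of_rat c0 + of_rat c1 * x + of_rat c2 * x ^ 2"
    "x ^ 3 - of_int a * x + of_int b = 0 \<Longrightarrow> v x = of_rat d0 + of_rat d1 * x + of_rat d2 * x ^ 2" for x
    using assms unfolding quad_on_roots_def by metis
  note uv = this
  show ?thesis unfolding quad_on_roots_def
    by (rule exI[of _ "c0 + d0"], rule exI[of _ "c1 + d1"], rule exI[of _ "c2 + d2"])
       (simp add: uv of_rat_add algebra_simps)
qed

lemma quad_on_roots_mult:
  assumes "quad_on_roots a b u" "quad_on_roots a b v"
  shows "quad_on_roots a b (\<lambda>x. u x * v x)"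
proof -
  obtain c0 c1 c2 d0 d1 d2 where uv:
    "x ^ 3 - of_int a * x + of_int b = 0 \<Longrightarrow> u x = of_rat c0 + of_rat c1 * x + of_rat c2 * x ^ 2"
    "x ^ 3 - of_int a * x + of_int b = 0 \<Longrightarrow> v x = of_rat d0 + of_rat d1 * x + of_rat d2 * x ^ 2" for x
    using assms unfolding quad_on_roots_def by metis
  have reduce: "(C0 + C1 * x + C2 * x ^ 2) * (D0 + D1 * x + D2 * x ^ 2)
      = (C0 * D0 - B * (C1 * D2 + C2 * D1))
        + (C0 * D1 + C1 * D0 + A * (C1 * D2 + C2 * D1) - B * C2 * D2) * x
        + (C0 * D2 + C1 * D1 + C2 * D0 + A * C2 * D2) * x ^ 2"
    (is "?l = ?r") if "x ^ 3 - A * x + B = 0" for A B C0 C1 C2 D0 D1 D2 x :: 'a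
  proof -
    \<comment> \<open>The first factor is the quotient in the division of the product, of degree 4
      in x, by the cubic.\<close>
    have "?l - ?r = (C2 * D2 * x + (C1 * D2 + C2 * D1)) * (x ^ 3 - A * x + B)"
      by Groebner_Basis.algebra
    then show ?thesis using that by simp
  qed
  show ?thesis unfolding quad_on_roots_def
  proof (rule exI[of _ "c0 * d0 - of_int b * (c1 * d2 + c2 * d1)"],
      rule exI[of _ "c0 * d1 + c1 * d0 + of_int a * (c1 * d2 + c2 * d1) - of_int b * c2 * d2"],
      rule exI[of _ "c0 * d2 + c1 * d1 + c2 * d0 + of_int a * c2 * d2"], intro allI impI)
    fix x :: 'a
    assume x: "x ^ 3 - of_int a * x + of_int b = 0"
    show "u x * v x = of_rat (c0 * d0 - of_int b * (c1 * d2 + c2 * d1))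
        + of_rat (c0 * d1 + c1 * d0 + of_int a * (c1 * d2 + c2 * d1) - of_int b * c2 * d2) * x
        + of_rat (c0 * d2 + c1 * d1 + c2 * d0 + of_int a * c2 * d2) * x ^ 2"
      unfolding uv[OF x] reduce[OF x] by (simp add: of_rat_add of_rat_mult of_rat_diff)
  qed
qed

section \<open>Expressions that also involve the square root of the discriminant\<close>

definition quad_on_conj :: "int \<Rightarrow> int \<Rightarrow> ('a::field_char_0 \<Rightarrow> 'a \<Rightarrow> 'a) \<Rightarrow> bool" where
  "quad_on_conj a b F \<longleftrightarrow> (\<exists>u v. quad_on_roots a b u \<and> quad_on_roots a b v \<and>
     (\<forall>x s. x ^ 3 - of_int a * x + of_int b = 0 \<longrightarrow> s ^ 2 = of_int (4 * a ^ 3 - 27 * b ^ 2) \<longrightarrow>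
        F x s = u x + v x * s))"

lemma quad_on_conj_quad_on_roots: "quad_on_roots a b u \<Longrightarrow> quad_on_conj a b (\<lambda>x s. u x)"
  unfolding quad_on_conj_def
  by (rule exI[of _ u], rule exI[of _ "\<lambda>_. of_rat 0"]) (use quad_on_roots_const[of a b 0] in simp)

lemma quad_on_conj_snd: "quad_on_conj a b (\<lambda>x s. s)"
  unfolding quad_on_conj_def
  by (rule exI[of _ "\<lambda>_. of_rat 0"], rule exI[of _ "\<lambda>_. of_rat 1"])
     (use quad_on_roots_const[of a b 0] quad_on_roots_const[of a b 1] in simp)

lemma quad_on_conj_add:
  assumes "quad_on_conj a b F" "quad_on_conj a b G"
  shows "quad_on_conj a b (\<lambda>x s. F x s + G x s)"
proof -
  obtain u v where F: "quad_on_roots a b u" "quad_on_roots a b v"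
    "\<And>x s. x ^ 3 - of_int a * x + of_int b = 0 \<Longrightarrow> s ^ 2 = of_int (4 * a ^ 3 - 27 * b ^ 2) \<Longrightarrow> F x s = u x + v x * s"
    using assms(1) unfolding quad_on_conj_def by blast
  obtain u' v' where G: "quad_on_roots a b u'" "quad_on_roots a b v'"
    "\<And>x s. x ^ 3 - of_int a * x + of_int b = 0 \<Longrightarrow> s ^ 2 = of_int (4 * a ^ 3 - 27 * b ^ 2) \<Longrightarrow> G x s = u' x + v' x * s"
    using assms(2) unfolding quad_on_conj_def by blast
  show ?thesis unfolding quad_on_conj_def
    by (rule exI[of _ "\<lambda>x. u x + u' x"], rule exI[of _ "\<lambda>x. v x + v' x"],
        intro conjI quad_on_roots_add F(1,2) G(1,2) allI impI)
       (simp add: F(3) G(3) algebra_simps)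
qed

lemma quad_on_conj_mult:
  assumes "quad_on_conj a b F" "quad_on_conj a b G"
  shows "quad_on_conj a b (\<lambda>x s. F x s * G x s)"
proof -
  obtain u v where F: "quad_on_roots a b u" "quad_on_roots a b v"
    "\<And>x s. x ^ 3 - of_int a * x + of_int b = 0 \<Longrightarrow> s ^ 2 = of_int (4 * a ^ 3 - 27 * b ^ 2) \<Longrightarrow> F x s = u x + v x * s"
    using assms(1) unfolding quad_on_conj_def by blast
  obtain u' v' where G: "quad_on_roots a b u'" "quad_on_roots a b v'"
    "\<And>x s. x ^ 3 - of_int a * x + of_int b = 0 \<Longrightarrow> s ^ 2 = of_int (4 * a ^ 3 - 27 * b ^ 2) \<Longrightarrow> G x s = u' x + v' x * s"
    using assms(2) unfolding quad_on_conj_def by blast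
  have reduce: "(p + q * s) * (p' + q' * s) = p * p' + D * (q * q') + (p * q' + q * p') * s"
    if "s ^ 2 = D" for p q p' q' s D :: 'a
    unfolding that[symmetric] by (simp add: algebra_simps power2_eq_square)
  show ?thesis unfolding quad_on_conj_def
    by (rule exI[of _ "\<lambda>x. u x * u' x + of_rat (of_int (4 * a ^ 3 - 27 * b ^ 2)) * (v x * v' x)"],
        rule exI[of _ "\<lambda>x. u x * v' x + v x * u' x"], intro conjI quad_on_roots_add quad_on_roots_mult quad_on_roots_const F(1,2) G(1,2) allI impI)
       (simp only: F(3) G(3) reduce of_rat_of_int_eq)
qed

lemma quad_on_conj_power: "quad_on_conj a b F \<Longrightarrow> quad_on_conj a b (\<lambda>x s. F x s ^ Suc k)"
  by (induction k) (use quad_on_conj_mult in force)+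

lemma quad_on_conj_conj: "quad_on_conj a b F \<Longrightarrow> quad_on_conj a b (\<lambda>x s. F x (- s))"
proof -
  assume "quad_on_conj a b F"
  then obtain u v where F: "quad_on_roots a b u" "quad_on_roots a b v"
    "\<And>x s. x ^ 3 - of_int a * x + of_int b = 0 \<Longrightarrow> s ^ 2 = of_int (4 * a ^ 3 - 27 * b ^ 2) \<Longrightarrow> F x s = u x + v x * s"
    unfolding quad_on_conj_def by blast
  show "quad_on_conj a b (\<lambda>x s. F x (- s))" unfolding quad_on_conj_def
    by (rule exI[of _ u], rule exI[of _ "\<lambda>x. of_rat (- 1) * v x"], intro conjI quad_on_roots_mult quad_on_roots_const F(1,2) allI impI)
       (simp add: F(3))
qed

section \<open>The cubic field and its normal closure\<close>

text \<open>Here \<open>roots\<close> only describes a set, so the distinctness of the three roots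
  has to be proved (\<open>distinct_roots\<close>). The assumption \<open>z_sq\<close> fixes z up to
  sign, which is why a sign \<epsilon> accompanies later formulas.\<close>

locale cubic_closure =
  fixes a b :: int and \<alpha> \<alpha>\<^sub>2 \<alpha>\<^sub>3 z :: "'a::field_char_0" and N :: "'a set" and \<sigma> :: "'a \<Rightarrow> 'a"
  assumes root: "\<alpha> ^ 3 - of_int a * \<alpha> + of_int b = 0"
    and degree: "rat_degree (rat_adjoin {\<alpha>}) = 3"
    and closure: "is_normal_closure (rat_adjoin {\<alpha>}) N"
    and roots: "{x \<in> N. x ^ 3 - of_int a * x + of_int b = 0} = {\<alpha>, \<alpha>\<^sub>2, \<alpha>\<^sub>3}"
    and z_sq: "z ^ 2 = of_int (4 * a ^ 3 - 27 * b ^ 2)"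
    and \<sigma>: "\<sigma> \<in> carrier (Gal N \<rat>)" "\<sigma> \<alpha> = \<alpha>\<^sub>2" "\<sigma> \<alpha>\<^sub>2 = \<alpha>\<^sub>3" "\<sigma> \<alpha>\<^sub>3 = \<alpha>"
begin

lemma normal_N: "normal_over_rat N"
  using closure by (simp add: is_normal_closure_def)

lemma subfield_N: "subfield N amb"
  and algebraic_N: "x \<in> N \<Longrightarrow> algebraic x"
  using normal_N by (simp_all add: normal_over_rat_def)

lemmas N_closed = subfield_ambD[OF subfield_N] subfield_ambD_of_int[OF subfield_N]

lemma \<alpha>_in_N: "\<alpha> \<in> N" and \<alpha>\<^sub>2_in_N: "\<alpha>\<^sub>2 \<in> N" and \<alpha>\<^sub>3_in_N: "\<alpha>\<^sub>3 \<in> N"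
  and root\<^sub>2: "\<alpha>\<^sub>2 ^ 3 - of_int a * \<alpha>\<^sub>2 + of_int b = 0"
  and root\<^sub>3: "\<alpha>\<^sub>3 ^ 3 - of_int a * \<alpha>\<^sub>3 + of_int b = 0"
  using roots by blast+

lemma quad_on_roots_closed:
  assumes "subfield K amb" "x \<in> K" "x ^ 3 - of_int a * x + of_int b = 0" "quad_on_roots a b u"
  shows "u x \<in> K"
proof -
  obtain c0 c1 c2 where "u x = of_rat c0 + of_rat c1 * x + of_rat c2 * x ^ 2"
    using assms(3,4) unfolding quad_on_roots_def by blast
  then show ?thesis using assms(2) by (simp add: subfield_ambD[OF assms(1)] power2_eq_square)
qed

text \<open>The values form a rational algebra inside N, hence consist of algebraic elements and are
  already a field.\<close>

lemma rat_adjoin_\<alpha>: "rat_adjoin {\<alpha>} = {u \<alpha> | u. quad_on_roots a b u}"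
proof
  let ?K = "{u \<alpha> | u. quad_on_roots a b u}"
  have "?K \<subseteq> N" using quad_on_roots_closed[OF subfield_N \<alpha>_in_N root] by auto
  have "subfield ?K amb"
  proof (rule algebraic_rat_algebra_subfield)
    show "of_rat q \<in> ?K" for q
      using quad_on_roots_const[of a b q, where 'a = 'a] unfolding mem_Collect_eq by (rule exI[of _ "\<lambda>_. of_rat q", OF conjI[OF refl]])
    show "x + y \<in> ?K" if "x \<in> ?K" "y \<in> ?K" for x y
      using that quad_on_roots_add by fast
    show "x * y \<in> ?K" if "x \<in> ?K" "y \<in> ?K" for x y
      using that quad_on_roots_mult by fast
    show "algebraic x" if "x \<in> ?K" for x
      using that \<open>?K \<subseteq> N\<close> algebraic_N by blast
  qed
  then show "rat_adjoin {\<alpha>} \<subseteq> ?K"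
    by (rule rat_adjoin_minimal) (use quad_on_roots_id[of a b] in auto)
  show "?K \<subseteq> rat_adjoin {\<alpha>}"
    using quad_on_roots_closed[OF subfield_rat_adjoin _ root] rat_adjoin_incl by blast
qed

section \<open>Consequences of the degree being three\<close>

text \<open>The powers 1, \<alpha>, \<alpha>^2 span L. A maximal independent subset of them has dim
  L = 3 elements, so it consists of all three, and they are distinct.\<close>

lemma linear_independent:
  assumes "of_rat c0 + of_rat c1 * \<alpha> + of_rat c2 * \<alpha> ^ 2 = 0"
  shows "c0 = 0" "c1 = 0" "c2 = 0"
proof -
  interpret vs: vector_space "\<lambda>(q::rat) (x::'a). of_rat q * x"
    by standard (simp_all add: of_rat_add of_rat_mult algebra_simps)
  let ?S = "{1, \<alpha>, \<alpha> ^ 2}"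
  have span: "rat_adjoin {\<alpha>} \<subseteq> vs.span ?S"
  proof
    fix x assume "x \<in> rat_adjoin {\<alpha>}"
    then obtain c0 c1 c2 where "x = of_rat c0 * 1 + of_rat c1 * \<alpha> + of_rat c2 * \<alpha> ^ 2"
      unfolding rat_adjoin_\<alpha> using root by (auto simp: quad_on_roots_def)
    then show "x \<in> vs.span ?S"
      using vs.span_add[OF vs.span_add[OF vs.span_scale vs.span_scale] vs.span_scale, of 1 ?S \<alpha> "\<alpha> ^ 2" c0 c1 c2]
        vs.span_base[of _ ?S] by simp
  qed
  have S_sub: "?S \<subseteq> rat_adjoin {\<alpha>}"
    using subfield_ambD(1,4)[OF subfield_rat_adjoin] rat_adjoin_incl[of "{\<alpha>}"]
    by (auto simp: power2_eq_square)
  obtain B where B: "B \<subseteq> ?S" "vs.independent B" "?S \<subseteq> vs.span B"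
    by (rule vs.maximal_independent_subset)
  have "vs.span B = vs.span (rat_adjoin {\<alpha>})"
  proof
    show "vs.span B \<subseteq> vs.span (rat_adjoin {\<alpha>})"
      using B(1) S_sub by (intro vs.span_mono) blast
    show "vs.span (rat_adjoin {\<alpha>}) \<subseteq> vs.span B"
      using order_trans[OF span vs.span_minimal[OF B(3) vs.subspace_span]]
      by (rule vs.span_minimal) (rule vs.subspace_span)
  qed
  then have "card B = 3"
    using vs.dim_eq_card[OF _ B(2)] degree by (simp add: rat_degree_def)
  moreover have "card ?S \<le> 3"
    by (auto simp: card_insert_if)
  ultimately have "B = ?S" using B(1) by (metis card_seteq finite.emptyI finite.insertI)
  then have "vs.independent ?S" "card ?S = 3" using B(2) \<open>card B = 3\<close> by simp_all
  have distinct: "1 \<noteq> \<alpha>" "1 \<noteq> \<alpha> ^ 2" "\<alpha> \<noteq> \<alpha> ^ 2"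
    using \<open>card ?S = 3\<close> by (auto simp: card_insert_if split: if_splits)
  define f where "f = (\<lambda>x. if x = 1 then c0 else if x = \<alpha> then c1 else c2)"
  have "(\<Sum>v\<in>?S. of_rat (f v) * v) = 0"
    using assms distinct by (simp add: f_def add.assoc)
  then have "f v = 0" if "v \<in> ?S" for v
    using vs.independentD[OF \<open>vs.independent ?S\<close> _ order_refl, of f] that by blast
  from this[of 1] this[of \<alpha>] this[of "\<alpha> ^ 2"]
  show "c0 = 0" "c1 = 0" "c2 = 0" using distinct by (simp_all add: f_def)
qed

text \<open>In a factorization one factor vanishes at \<alpha>. By linear independence its degree is
  at least 3, which leaves a constant for the other factor.\<close>

lemma irreducible_cubic: "irreducible [:rat_of_int b, - of_int a, 0, 1:]" (is "irreducible ?f")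
proof (rule irreducibleI)
  have small: "p = 0" if "poly (map_poly of_rat p) \<alpha> = 0" "degree p \<le> 2" for p :: "rat poly"
  proof -
    obtain c0 p1 c1 p2 c2 p3 where p: "p = pCons c0 p1" "p1 = pCons c1 p2" "p2 = pCons c2 p3"
      by (metis pCons_cases)
    with that(2) have "p3 = 0" by (simp split: if_splits)
    then have "of_rat c0 + of_rat c1 * \<alpha> + of_rat c2 * \<alpha> ^ 2 = 0"
      using that(1) by (simp add: p map_poly_pCons power2_eq_square algebra_simps)
    from linear_independent[OF this] show ?thesis by (simp add: p \<open>p3 = 0\<close>)
  qed
  show "?f \<noteq> 0" "\<not> ?f dvd 1" by (simp_all add: is_unit_poly_iff)
  fix p q assume pq: "?f = p * q"
  then have nz: "p \<noteq> 0" "q \<noteq> 0" by auto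
  have deg: "degree p + degree q = 3"
    using degree_mult_eq[OF nz] unfolding pq[symmetric] by simp
  have "poly (map_poly of_rat (p * q)) \<alpha> = 0"
    using root unfolding pq[symmetric] by (simp add: map_poly_pCons of_rat_minus power3_eq_cube algebra_simps)
  then have "poly (map_poly of_rat p) \<alpha> = 0 \<or> poly (map_poly of_rat q) \<alpha> = 0"
    by (simp add: poly_of_rat_mult)
  then have "degree p \<ge> 3 \<or> degree q \<ge> 3"
    using small nz by (metis Suc_leI not_less_eq_eq numeral_2_eq_2 numeral_3_eq_3 linorder_not_le)
  then have "degree p = 0 \<or> degree q = 0" using deg by auto
  then show "is_unit p \<or> is_unit q" using nz by (auto simp: is_unit_iff_degree)
qed

section \<open>Automorphisms and the three roots\<close>

lemma Gal_hom:
  assumes "\<tau> \<in> carrier (Gal N K)"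
  shows "x \<in> N \<Longrightarrow> \<tau> x \<in> N" "x \<in> N \<Longrightarrow> y \<in> N \<Longrightarrow> \<tau> (x + y) = \<tau> x + \<tau> y"
    "x \<in> N \<Longrightarrow> y \<in> N \<Longrightarrow> \<tau> (x * y) = \<tau> x * \<tau> y" "\<tau> (of_rat q) = of_rat q"
    "\<tau> (of_int n) = of_int n" "x \<in> N \<Longrightarrow> \<tau> (- x) = - \<tau> x"
    "x \<in> N \<Longrightarrow> y \<in> N \<Longrightarrow> \<tau> (x - y) = \<tau> x - \<tau> y" "x \<in> N \<Longrightarrow> \<tau> (x ^ k) = \<tau> x ^ k"
    "inj_on \<tau> N" "x \<in> K \<Longrightarrow> \<tau> x = x" "\<tau> \<in> extensional N"
proof -
  have hom: "\<tau> \<in> ring_hom (amb\<lparr>carrier := N\<rparr>) (amb\<lparr>carrier := N\<rparr>)" and bij: "\<tau> \<in> Bij N"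
    and fix_K: "\<And>x. x \<in> K \<Longrightarrow> \<tau> x = x"
    using assms by (auto simp: Gal_def)
  show closed: "\<And>x. x \<in> N \<Longrightarrow> \<tau> x \<in> N" using ring_hom_closed[OF hom] by simp
  show add: "\<And>x y. x \<in> N \<Longrightarrow> y \<in> N \<Longrightarrow> \<tau> (x + y) = \<tau> x + \<tau> y"
    using ring_hom_add[OF hom] by simp
  show mult: "\<And>x y. x \<in> N \<Longrightarrow> y \<in> N \<Longrightarrow> \<tau> (x * y) = \<tau> x * \<tau> y"
    using ring_hom_mult[OF hom] by simp
  have one: "\<tau> 1 = 1" using ring_hom_one[OF hom] by simp
  have N0: "0 \<in> N" using N_closed(8)[of 0] by simp
  then have zero: "\<tau> 0 = 0" using add[of 0 0] by simp
  show uminus: "\<tau> (- x) = - \<tau> x" if "x \<in> N" for x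
    using add[OF that N_closed(3)[OF that]] zero by (simp add: eq_neg_iff_add_eq_0 add.commute)
  show "\<tau> (x - y) = \<tau> x - \<tau> y" if "x \<in> N" "y \<in> N" for x y
    using add[OF that(1) N_closed(3)[OF that(2)]] uminus[OF that(2)] by simp
  have pow: "x ^ k \<in> N \<and> \<tau> (x ^ k) = \<tau> x ^ k" if "x \<in> N" for x k
    by (induction k) (use that mult one N_closed in auto)
  then show "\<tau> (x ^ k) = \<tau> x ^ k" if "x \<in> N" for x k using that by blast
  have nat: "\<tau> (of_nat n) = of_nat n" for n
    by (induction n) (use add one zero N_closed(1) subfield_ambD_of_int[OF subfield_N, of "int _"] in auto)
  show int: "\<tau> (of_int n) = of_int n" for n
    by (cases n rule: int_cases2) (use nat uminus subfield_ambD_of_int[OF subfield_N, of "int _"] in auto)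
  show "\<tau> (of_rat q) = of_rat q" for q
  proof -
    obtain m n where q: "q = Rat.Fract m n" "n > 0" by (rule Rat_cases)
    have "(of_int n :: 'a) * of_rat q = of_int m" using q by (simp add: of_rat_rat)
    then have "of_int n * \<tau> (of_rat q) = (of_int m :: 'a)"
      using mult[OF subfield_ambD_of_int[OF subfield_N, of n] N_closed(8)[of q]] int by metis
    then show ?thesis using q by (simp add: of_rat_rat field_simps)
  qed
  show "inj_on \<tau> N" "\<tau> \<in> extensional N" using bij by (auto simp: Bij_def bij_betw_def)
  show "\<And>x. x \<in> K \<Longrightarrow> \<tau> x = x" by (fact fix_K)
qed

lemma Gal_root:
  assumes "\<tau> \<in> carrier (Gal N K)" "x \<in> {\<alpha>, \<alpha>\<^sub>2, \<alpha>\<^sub>3}"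
  shows "\<tau> x \<in> {\<alpha>, \<alpha>\<^sub>2, \<alpha>\<^sub>3}"
proof -
  note G = Gal_hom[OF assms(1)]
  have x: "x \<in> N" "x ^ 3 - of_int a * x + of_int b = 0" using assms(2) roots by auto
  then have "\<tau> (x ^ 3 - of_int a * x + of_int b) = \<tau> 0" by simp
  then have "\<tau> x ^ 3 - of_int a * \<tau> x + of_int b = 0"
    using x(1) G(5)[of 0] by (simp add: G N_closed power3_eq_cube)
  then show ?thesis using G(1)[OF x(1)] roots by blast
qed

text \<open>Since \<sigma> runs through the roots cyclically, one coincidence among them would make
  all three equal. Normality of N would then write the cubic as a power of x - \<alpha>, and its
  vanishing quadratic coefficient would force \<alpha> = 0.\<close>

lemma distinct_roots: "\<alpha> \<noteq> \<alpha>\<^sub>2" "\<alpha> \<noteq> \<alpha>\<^sub>3" "\<alpha>\<^sub>2 \<noteq> \<alpha>\<^sub>3"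
proof -
  have inj: "inj_on \<sigma> N" by (rule Gal_hom(9)[OF \<sigma>(1)])
  have "\<not> (\<alpha>\<^sub>2 = \<alpha> \<and> \<alpha>\<^sub>3 = \<alpha>)"
  proof
    assume eq: "\<alpha>\<^sub>2 = \<alpha> \<and> \<alpha>\<^sub>3 = \<alpha>"
    define f where "f = [:rat_of_int b, - of_int a, 0, 1:]"
    have mf: "map_poly of_rat f = [:of_int b :: 'a, - of_int a, 0, 1:]"
      by (simp add: f_def map_poly_pCons of_rat_minus)
    have f_root: "poly (map_poly of_rat f) x = x ^ 3 - of_int a * x + of_int b" for x :: 'a
      by (simp add: mf power3_eq_cube algebra_simps)
    have "splits_in N f"
      using normal_N irreducible_cubic \<alpha>_in_N root
      unfolding normal_over_rat_def f_root[symmetric] f_def[symmetric] by blast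
    then obtain rs where rs: "set rs \<subseteq> N" "map_poly of_rat f = (\<Prod>r\<leftarrow>rs. [:- r, 1 :: 'a:])"
      by (auto simp: splits_in_def f_def)
    have "r = \<alpha>" if "r \<in> set rs" for r
    proof -
      have "poly (map_poly of_rat f) r = 0"
        using that unfolding rs(2) by (induction rs) auto
      then show ?thesis using rs(1) that roots eq unfolding f_root by blast
    qed
    then have "rs = replicate (length rs) \<alpha>" by (simp add: replicate_length_same)
    then have power: "map_poly of_rat f = [:- \<alpha>, 1:] ^ length rs"
      by (metis rs(2) map_replicate prod_list_replicate)
    then have "degree (map_poly of_rat f :: 'a poly) = length rs"
      by (simp add: degree_power_eq)
    then have "length rs = 3" by (simp add: mf)
    then have "coeff (map_poly of_rat f :: 'a poly) 2 = - 3 * \<alpha>"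
      unfolding power by (simp add: power3_eq_cube numeral_2_eq_2)
    then have "\<alpha> = 0" by (simp add: mf numeral_2_eq_2)
    then show False using linear_independent(2)[of 0 1 0] by simp
  qed
  then show "\<alpha> \<noteq> \<alpha>\<^sub>2" "\<alpha> \<noteq> \<alpha>\<^sub>3" "\<alpha>\<^sub>2 \<noteq> \<alpha>\<^sub>3"
    using \<sigma> inj_onD[OF inj] \<alpha>_in_N \<alpha>\<^sub>2_in_N \<alpha>\<^sub>3_in_N by metis+
qed

text \<open>Subtracting the equations of two distinct roots and dividing by their difference gives
  x^2 + x y + y^2 = a. Everything is expressed through \<alpha> and a, so that later identities
  follow by ideal membership.\<close>

lemma vieta:
  "\<alpha>\<^sub>2 + \<alpha>\<^sub>3 = - \<alpha>" "\<alpha>\<^sub>2 * \<alpha>\<^sub>3 = \<alpha> ^ 2 - of_int a" "of_int b = \<alpha> * of_int a - \<alpha> ^ 3"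
proof -
  have diff: "x ^ 2 + x * y + y ^ 2 = of_int a"
    if "x \<noteq> y" "x ^ 3 - of_int a * x + of_int b = 0" "y ^ 3 - of_int a * y + of_int b = 0" for x y :: 'a
  proof -
    have "(x - y) * (x ^ 2 + x * y + y ^ 2 - of_int a)
        = (x ^ 3 - of_int a * x + of_int b) - (y ^ 3 - of_int a * y + of_int b)"
      by (simp add: algebra_simps power2_eq_square power3_eq_cube)
    then show ?thesis using that by simp
  qed
  have eqs: "\<alpha> ^ 2 + \<alpha> * \<alpha>\<^sub>2 + \<alpha>\<^sub>2 ^ 2 = of_int a" "\<alpha> ^ 2 + \<alpha> * \<alpha>\<^sub>3 + \<alpha>\<^sub>3 ^ 2 = of_int a"
    using diff distinct_roots root root\<^sub>2 root\<^sub>3 by blast+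
  have "(\<alpha>\<^sub>2 - \<alpha>\<^sub>3) * (\<alpha> + \<alpha>\<^sub>2 + \<alpha>\<^sub>3)
      = (\<alpha> ^ 2 + \<alpha> * \<alpha>\<^sub>2 + \<alpha>\<^sub>2 ^ 2) - (\<alpha> ^ 2 + \<alpha> * \<alpha>\<^sub>3 + \<alpha>\<^sub>3 ^ 2)"
    by (simp add: algebra_simps power2_eq_square)
  then have "\<alpha> + \<alpha>\<^sub>2 + \<alpha>\<^sub>3 = 0" using eqs distinct_roots by simp
  then show sum: "\<alpha>\<^sub>2 + \<alpha>\<^sub>3 = - \<alpha>" by (simp add: eq_neg_iff_add_eq_0 add.commute add.left_commute)
  have \<alpha>\<^sub>3: "\<alpha>\<^sub>3 = - \<alpha> - \<alpha>\<^sub>2" by (simp flip: sum)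
  show "\<alpha>\<^sub>2 * \<alpha>\<^sub>3 = \<alpha> ^ 2 - of_int a"
    unfolding \<alpha>\<^sub>3 eqs(1)[symmetric] by (simp add: algebra_simps power2_eq_square)
  show "of_int b = \<alpha> * of_int a - \<alpha> ^ 3" using root by (simp add: algebra_simps eq_neg_iff_add_eq_0)
qed

text \<open>The number z^2 is the discriminant, that is, the square of the product of the root
  differences. The second formula uses (\<alpha> - \<open>\<alpha>\<^sub>2\<close>)(\<alpha> -
  \<open>\<alpha>\<^sub>3\<close>) = f'(\<alpha>) = 3 \<alpha>^2 - a.\<close>

lemma obtain_sign:
  obtains \<epsilon> :: int where "\<epsilon> = 1 \<or> \<epsilon> = - 1" "\<epsilon> * \<epsilon> = 1"
    "z = of_int \<epsilon> * ((\<alpha> - \<alpha>\<^sub>2) * (\<alpha> - \<alpha>\<^sub>3) * (\<alpha>\<^sub>2 - \<alpha>\<^sub>3))"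
    "z = of_int \<epsilon> * ((3 * \<alpha> ^ 2 - of_int a) * (\<alpha>\<^sub>2 - \<alpha>\<^sub>3))"
proof -
  let ?\<delta> = "(\<alpha> - \<alpha>\<^sub>2) * (\<alpha> - \<alpha>\<^sub>3) * (\<alpha>\<^sub>2 - \<alpha>\<^sub>3)"
  have id: "((\<alpha> - x) * (\<alpha> - y) * (x - y)) ^ 2 = 4 * A ^ 3 - 27 * B ^ 2"
    "(\<alpha> - x) * (\<alpha> - y) = 3 * \<alpha> ^ 2 - A"
    if "x + y = - \<alpha>" "x * y = \<alpha> ^ 2 - A" "B = \<alpha> * A - \<alpha> ^ 3" for x y A B
    using that by Groebner_Basis.algebra+
  note id = id[OF vieta]
  have "z ^ 2 = ?\<delta> ^ 2" using z_sq id(1) by simp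
  then have "z = ?\<delta> \<or> z = - ?\<delta>" by (simp add: power2_eq_iff)
  then show ?thesis using that[of 1] that[of "-1"] id(2) by auto
qed

lemma z_nonzero: "z \<noteq> 0"
  using obtain_sign distinct_roots by (metis eq_iff_diff_eq_0 mult_eq_0_iff of_int_eq_0_iff zero_neq_one zero_neq_neg_one)

lemma z_in_N: "z \<in> N"
proof -
  obtain \<epsilon> where "z = of_int \<epsilon> * ((\<alpha> - \<alpha>\<^sub>2) * (\<alpha> - \<alpha>\<^sub>3) * (\<alpha>\<^sub>2 - \<alpha>\<^sub>3))"
    using obtain_sign by metis
  then show ?thesis by (simp only: N_closed \<alpha>_in_N \<alpha>\<^sub>2_in_N \<alpha>\<^sub>3_in_N)
qed

lemma quad_on_conj_closed:
  assumes "subfield K amb" "x \<in> K" "x ^ 3 - of_int a * x + of_int b = 0"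
    "s \<in> K" "s ^ 2 = of_int (4 * a ^ 3 - 27 * b ^ 2)" "quad_on_conj a b F"
  shows "F x s \<in> K"
proof -
  obtain u v where F: "quad_on_roots a b u" "quad_on_roots a b v" "F x s = u x + v x * s"
    using assms(3,5,6) unfolding quad_on_conj_def by blast
  then show ?thesis
    using quad_on_roots_closed[OF assms(1,2,3)] assms(4) by (simp add: subfield_ambD[OF assms(1)])
qed

section \<open>The normal closure\<close>

text \<open>The roots have sum 0 and sum of squares 2 a, so the trace is 3 c_0 + 2 a c_2.\<close>

lemma trace_Rats:
  assumes "quad_on_roots a b u"
  shows "u \<alpha> + u \<alpha>\<^sub>2 + u \<alpha>\<^sub>3 \<in> \<rat>"
proof -
  obtain c0 c1 c2 where u:
    "x ^ 3 - of_int a * x + of_int b = 0 \<Longrightarrow> u x = of_rat c0 + of_rat c1 * x + of_rat c2 * x ^ 2" for x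
    using assms unfolding quad_on_roots_def by blast
  have "c0 + c1 * x + c2 * x ^ 2 + (c0 + c1 * y + c2 * y ^ 2) + (c0 + c1 * w + c2 * w ^ 2) = 3 * c0 + 2 * A * c2"
    if "y + w = - x" "y * w = x ^ 2 - A" for x y w A c0 c1 c2 :: 'a
    using that by Groebner_Basis.algebra
  note this[OF vieta(1,2), of "of_rat c0" "of_rat c1" "of_rat c2"]
  moreover have "3 * of_rat c0 + 2 * of_int a * of_rat c2 \<in> (\<rat> :: 'a set)"
    by (intro Rats_add Rats_mult) simp_all
  ultimately show ?thesis by (simp only: u[OF root] u[OF root\<^sub>2] u[OF root\<^sub>3])
qed

lemma N_eq: "N = {F \<alpha> z | F. quad_on_conj a b F}"
proof -
  define E where "E = {F \<alpha> z | F. quad_on_conj a b F}"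
  have E_N: "E \<subseteq> N" using quad_on_conj_closed[OF subfield_N \<alpha>_in_N root z_in_N z_sq] by (auto simp: E_def)
  have E: "subfield E amb"
  proof (rule algebraic_rat_algebra_subfield)
    show "of_rat q \<in> E" for q
      unfolding E_def using quad_on_conj_quad_on_roots[OF quad_on_roots_const[of a b q]] by fast
    show "x + y \<in> E" if "x \<in> E" "y \<in> E" for x y
      using that quad_on_conj_add unfolding E_def by fast
    show "x * y \<in> E" if "x \<in> E" "y \<in> E" for x y
      using that quad_on_conj_mult unfolding E_def by fast
    show "algebraic x" if "x \<in> E" for x
      using that E_N algebraic_N by blast
  qed
  note E_closed = subfield_ambD[OF E] subfield_ambD_of_int[OF E]
  have \<alpha>_E: "\<alpha> \<in> E" unfolding E_def using quad_on_conj_quad_on_roots[OF quad_on_roots_id[of a b]] by fast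
  have z_E: "z \<in> E" unfolding E_def using quad_on_conj_snd[of a b] by fast
  have "\<alpha>\<^sub>2 \<in> E \<and> \<alpha>\<^sub>3 \<in> E"
  proof -
    obtain \<epsilon> :: int where \<epsilon>: "\<epsilon> * \<epsilon> = 1" "z = of_int \<epsilon> * ((3 * \<alpha> ^ 2 - of_int a) * (\<alpha>\<^sub>2 - \<alpha>\<^sub>3))"
      using obtain_sign by metis
    \<comment> \<open>Dividing z by f'(\<alpha>) yields the difference of the other two roots up to
      sign. Together with their sum -\<alpha> this puts both of them into E.\<close>
    then have "3 * \<alpha> ^ 2 - of_int a \<noteq> 0" using z_nonzero by auto
    moreover have "of_int \<epsilon> * z = of_int (\<epsilon> * \<epsilon>) * ((3 * \<alpha> ^ 2 - of_int a) * (\<alpha>\<^sub>2 - \<alpha>\<^sub>3))"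
      unfolding \<epsilon>(2) by simp
    ultimately have d: "\<alpha>\<^sub>2 - \<alpha>\<^sub>3 = of_int \<epsilon> * z / (of_int 3 * (\<alpha> * \<alpha>) - of_int a)"
      using \<epsilon>(1) by (simp add: field_simps power2_eq_square)
    have "\<alpha>\<^sub>2 - \<alpha>\<^sub>3 \<in> E" unfolding d by (intro E_closed \<alpha>_E z_E)
    then obtain d where d: "d = \<alpha>\<^sub>2 - \<alpha>\<^sub>3" "d \<in> E" by blast
    have "(- \<alpha> + d) / of_int 2 \<in> E" "(- \<alpha> - d) / of_int 2 \<in> E"
      by (intro E_closed \<alpha>_E d(2))+
    then show ?thesis unfolding vieta(1)[symmetric] d(1) by simp
  qed
  then have roots_E: "x \<in> E" if "x \<in> {\<alpha>, \<alpha>\<^sub>2, \<alpha>\<^sub>3}" for x using that \<alpha>_E by blast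
  have "normal_over_rat E" unfolding normal_over_rat_def
  proof (intro conjI allI impI ballI E)
    show "algebraic x" if "x \<in> E" for x using that E_N algebraic_N by blast
  next
    fix p :: "rat poly"
    assume p: "irreducible p \<and> (\<exists>x\<in>E. poly (map_poly of_rat p) x = 0)"
    then obtain F where F: "quad_on_conj a b F" "poly (map_poly of_rat p) (F \<alpha> z) = 0" unfolding E_def by blast
    define ys where "ys = concat (map (\<lambda>x. [F x z, F x (- z)]) [\<alpha>, \<alpha>\<^sub>2, \<alpha>\<^sub>3])"
    have ys_E: "set ys \<subseteq> E"
      using quad_on_conj_closed[OF E roots_E _ z_E z_sq F(1)] root root\<^sub>2 root\<^sub>3
        quad_on_conj_closed[OF E roots_E _ E_closed(3)[OF z_E] _ F(1)] z_sq
      by (auto simp: ys_def)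
    have "(\<Sum>y\<leftarrow>ys. y ^ Suc k) \<in> \<rat>" for k
    proof -
      obtain u v where uv: "quad_on_roots a b u" "\<And>x s. x ^ 3 - of_int a * x + of_int b = 0 \<Longrightarrow>
          s ^ 2 = of_int (4 * a ^ 3 - 27 * b ^ 2) \<Longrightarrow> F x s ^ Suc k = u x + v x * s"
        using quad_on_conj_power[OF F(1), of k] unfolding quad_on_conj_def by blast
      \<comment> \<open>The part of the power that is odd in z cancels between z and -z; summing
        over x leaves a trace.\<close>
      have "F x z ^ Suc k + F x (- z) ^ Suc k = 2 * u x" if "x ^ 3 - of_int a * x + of_int b = 0" for x
        using uv(2)[OF that z_sq] uv(2)[OF that, of "- z"] z_sq by simp
      then have "(\<Sum>y\<leftarrow>ys. y ^ Suc k) = 2 * (u \<alpha> + u \<alpha>\<^sub>2 + u \<alpha>\<^sub>3)"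
        using root root\<^sub>2 root\<^sub>3 by (simp add: ys_def algebra_simps del: power_Suc)
      then show ?thesis using Rats_mult[OF _ trace_Rats[OF uv(1)], of 2] by (simp only: Rats_number_of)
    qed
    then have "coeff (\<Prod>y\<leftarrow>ys. [:- y, 1:]) n \<in> \<rat>" for n
      by (rule power_sums_Rats_imp_coeff_Rats)
    then obtain c where c: "(\<Prod>y\<leftarrow>ys. [:- y, 1:]) = map_poly of_rat c"
      by (rule ratpolyE)
    have c_root: "poly (map_poly of_rat c) y = 0 \<longleftrightarrow> y \<in> set ys" for y
      unfolding c[symmetric] by (induction ys) auto
    \<comment> \<open>The roots of p exist in the normal field N. It remains to locate them among
      the six values \<open>ys\<close>, using the common root F(\<alpha>, z) of p and c.\<close>
    have "splits_in N p"
      using p E_N normal_N unfolding normal_over_rat_def by blast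
    then obtain rs where rs: "set rs \<subseteq> N"
      "map_poly of_rat p = smult (of_rat (lead_coeff p)) (\<Prod>r\<leftarrow>rs. [:- r, 1 :: 'a:])"
      by (auto simp: splits_in_def)
    have "r \<in> E" if "r \<in> set rs" for r
    proof -
      have "poly (\<Prod>r\<leftarrow>rs. [:- r, 1:]) r = 0" using that by (induction rs) auto
      then have "poly (map_poly of_rat p) r = 0" unfolding rs(2) by simp
      moreover have "poly (map_poly of_rat c) (F \<alpha> z) = 0" unfolding c_root by (simp add: ys_def)
      ultimately show ?thesis
        using irreducible_root_transfer[OF _ F(2)] p c_root ys_E by blast
    qed
    then show "splits_in E p" unfolding splits_in_def using rs(2) by blast
  qed
  moreover have "rat_adjoin {\<alpha>} \<subseteq> E" using rat_adjoin_minimal[OF E] \<alpha>_E by blast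
  ultimately show ?thesis using closure E_N unfolding is_normal_closure_def E_def[symmetric] by blast
qed

section \<open>The Galois group and the Hopf algebra\<close>

lemma Rats_subset_N: "\<rat> \<subseteq> N"
  using N_closed(8) by (auto simp: Rats_def)

sublocale G: group "Gal N \<rat>"
  by (rule group_Gal[OF subfield_N Rats_subset_N])

lemma Gal_quad_on_roots:
  assumes "\<tau> \<in> carrier (Gal N K)" "x \<in> {\<alpha>, \<alpha>\<^sub>2, \<alpha>\<^sub>3}" "quad_on_roots a b u"
  shows "\<tau> (u x) = u (\<tau> x)"
proof -
  note G = Gal_hom[OF assms(1)]
  obtain c0 c1 c2 where u:
    "x ^ 3 - of_int a * x + of_int b = 0 \<Longrightarrow> u x = of_rat c0 + of_rat c1 * x + of_rat c2 * x ^ 2" for x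
    using assms(3) unfolding quad_on_roots_def by blast
  have x: "x \<in> N" "x ^ 3 - of_int a * x + of_int b = 0" using assms(2) roots by auto
  have \<tau>x: "\<tau> x ^ 3 - of_int a * \<tau> x + of_int b = 0" using Gal_root[OF assms(1,2)] roots by auto
  show ?thesis unfolding u[OF x(2)] u[OF \<tau>x] using x(1) by (simp add: G N_closed power2_eq_square)
qed

lemma Gal_quad_on_conj:
  assumes "\<tau> \<in> carrier (Gal N K)" "quad_on_conj a b F"
  shows "\<tau> (F \<alpha> z) = F (\<tau> \<alpha>) (\<tau> z)"
proof -
  note G = Gal_hom[OF assms(1)]
  obtain u v where F: "quad_on_roots a b u" "quad_on_roots a b v"
    "\<And>x s. x ^ 3 - of_int a * x + of_int b = 0 \<Longrightarrow> s ^ 2 = of_int (4 * a ^ 3 - 27 * b ^ 2) \<Longrightarrow> F x s = u x + v x * s"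
    using assms(2) unfolding quad_on_conj_def by blast
  have \<tau>\<alpha>: "\<tau> \<alpha> ^ 3 - of_int a * \<tau> \<alpha> + of_int b = 0" using Gal_root[OF assms(1), of \<alpha>] roots by blast
  have \<tau>z: "\<tau> z ^ 2 = of_int (4 * a ^ 3 - 27 * b ^ 2)"
    using G(8)[OF z_in_N, of 2] G(5) z_sq by metis
  have "u \<alpha> \<in> N" "v \<alpha> \<in> N" using quad_on_roots_closed[OF subfield_N \<alpha>_in_N root] F by auto
  then show ?thesis unfolding F(3)[OF root z_sq] F(3)[OF \<tau>\<alpha> \<tau>z]
    using z_in_N F(1,2) by (simp add: G N_closed Gal_quad_on_roots[OF assms(1)])
qed

lemma Gal_eqI:
  assumes "\<tau> \<in> carrier (Gal N K)" "\<tau>' \<in> carrier (Gal N K')" "\<tau> \<alpha> = \<tau>' \<alpha>" "\<tau> z = \<tau>' z"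
  shows "\<tau> = \<tau>'"
proof (rule extensionalityI[of _ N])
  show "\<tau> \<in> extensional N" "\<tau>' \<in> extensional N" using assms Gal_hom(11) by blast+
  fix x assume "x \<in> N"
  then obtain F where "quad_on_conj a b F" "x = F \<alpha> z" unfolding N_eq by blast
  then show "\<tau> x = \<tau>' x" using Gal_quad_on_conj assms by metis
qed

text \<open>Apart from a sign, z is the product of the root differences, so an automorphism
  multiplies it by the sign of the permutation of the roots. The cases are the identity, the
  transposition fixing \<alpha>, and the 3-cycle.\<close>

lemma Gal_z:
  assumes "\<tau> \<in> carrier (Gal N K)"
  shows "\<tau> \<alpha> = \<alpha> \<Longrightarrow> \<tau> \<alpha>\<^sub>2 = \<alpha>\<^sub>2 \<Longrightarrow> \<tau> z = z"
    and "\<tau> \<alpha> = \<alpha> \<Longrightarrow> \<tau> \<alpha>\<^sub>2 = \<alpha>\<^sub>3 \<Longrightarrow> \<tau> z = - z"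
    and "\<tau> \<alpha> = \<alpha>\<^sub>2 \<Longrightarrow> \<tau> \<alpha>\<^sub>2 = \<alpha>\<^sub>3 \<Longrightarrow> \<tau> z = z"
    and "\<tau> \<alpha> = \<alpha> \<Longrightarrow> \<tau> \<alpha>\<^sub>2 = \<alpha>\<^sub>3 \<Longrightarrow> \<tau> \<alpha>\<^sub>3 = \<alpha>\<^sub>2"
    and "\<tau> \<alpha> = \<alpha> \<Longrightarrow> \<tau> \<alpha>\<^sub>2 = \<alpha>\<^sub>2 \<or> \<tau> \<alpha>\<^sub>2 = \<alpha>\<^sub>3"
proof -
  note G = Gal_hom[OF assms]
  obtain \<epsilon> where \<epsilon>: "z = of_int \<epsilon> * ((\<alpha> - \<alpha>\<^sub>2) * (\<alpha> - \<alpha>\<^sub>3) * (\<alpha>\<^sub>2 - \<alpha>\<^sub>3))"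
    using obtain_sign by metis
  have \<alpha>\<^sub>3: "\<alpha>\<^sub>3 = - \<alpha> - \<alpha>\<^sub>2" by (simp flip: vieta(1))
  have \<tau>\<alpha>\<^sub>3: "\<tau> \<alpha>\<^sub>3 = - \<tau> \<alpha> - \<tau> \<alpha>\<^sub>2"
    unfolding \<alpha>\<^sub>3 by (simp add: G N_closed \<alpha>_in_N \<alpha>\<^sub>2_in_N)
  have \<tau>z: "\<tau> z = of_int \<epsilon> * ((\<tau> \<alpha> - \<tau> \<alpha>\<^sub>2) * (\<tau> \<alpha> - \<tau> \<alpha>\<^sub>3) * (\<tau> \<alpha>\<^sub>2 - \<tau> \<alpha>\<^sub>3))"
    unfolding \<epsilon> by (simp add: G N_closed \<alpha>_in_N \<alpha>\<^sub>2_in_N \<alpha>\<^sub>3_in_N)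
  show "\<tau> z = z" if "\<tau> \<alpha> = \<alpha>" "\<tau> \<alpha>\<^sub>2 = \<alpha>\<^sub>2"
    using \<tau>z \<tau>\<alpha>\<^sub>3 \<alpha>\<^sub>3 \<epsilon> that by simp
  show swap: "\<tau> \<alpha>\<^sub>3 = \<alpha>\<^sub>2" if "\<tau> \<alpha> = \<alpha>" "\<tau> \<alpha>\<^sub>2 = \<alpha>\<^sub>3"
    using \<tau>\<alpha>\<^sub>3 \<alpha>\<^sub>3 that by simp
  show "\<tau> z = - z" if t: "\<tau> \<alpha> = \<alpha>" "\<tau> \<alpha>\<^sub>2 = \<alpha>\<^sub>3"
    unfolding \<tau>z swap[OF t] t by (subst \<epsilon>) (simp add: algebra_simps)
  show "\<tau> z = z" if t: "\<tau> \<alpha> = \<alpha>\<^sub>2" "\<tau> \<alpha>\<^sub>2 = \<alpha>\<^sub>3"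
  proof -
    have "\<tau> \<alpha>\<^sub>3 = \<alpha>" using \<tau>\<alpha>\<^sub>3 \<alpha>\<^sub>3 t by simp
    then show ?thesis unfolding \<tau>z t by (subst \<epsilon>) (simp add: algebra_simps)
  qed
  show "\<tau> \<alpha>\<^sub>2 = \<alpha>\<^sub>2 \<or> \<tau> \<alpha>\<^sub>2 = \<alpha>\<^sub>3" if "\<tau> \<alpha> = \<alpha>"
    using Gal_root[OF assms, of \<alpha>\<^sub>2] that inj_onD[OF G(9), of \<alpha>\<^sub>2 \<alpha>] \<alpha>_in_N \<alpha>\<^sub>2_in_N distinct_roots by auto
qed

section \<open>The cyclic group J and the stabilizer of L\<close>

lemma \<sigma>_z: "\<sigma> z = z" by (rule Gal_z(3)[OF \<sigma>(1,2,3)])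

definition \<sigma>\<^sub>2 where "\<sigma>\<^sub>2 = \<sigma> [^]\<^bsub>Gal N \<rat>\<^esub> (2::nat)"

abbreviation "\<iota> \<equiv> \<one>\<^bsub>Gal N \<rat>\<^esub>"

lemma \<sigma>\<^sub>2: "\<sigma>\<^sub>2 = \<sigma> \<otimes>\<^bsub>Gal N \<rat>\<^esub> \<sigma>"
  using \<sigma>(1) by (simp add: \<sigma>\<^sub>2_def numeral_2_eq_2)

lemma \<sigma>\<^sub>2_carrier: "\<sigma>\<^sub>2 \<in> carrier (Gal N \<rat>)"
  unfolding \<sigma>\<^sub>2 using \<sigma>(1) by simp

lemma \<sigma>\<^sub>2_apply: "x \<in> N \<Longrightarrow> \<sigma>\<^sub>2 x = \<sigma> (\<sigma> x)"
  unfolding \<sigma>\<^sub>2 by (rule Gal_mult_apply[OF \<sigma>(1) \<sigma>(1)])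

lemma \<sigma>\<^sub>2_values: "\<sigma>\<^sub>2 \<alpha> = \<alpha>\<^sub>3" "\<sigma>\<^sub>2 z = z"
  using \<sigma>\<^sub>2_apply \<alpha>_in_N z_in_N \<sigma> \<sigma>_z by simp_all

lemma \<sigma>_cubed: "\<sigma> \<otimes>\<^bsub>Gal N \<rat>\<^esub> \<sigma>\<^sub>2 = \<iota>" "\<sigma>\<^sub>2 \<otimes>\<^bsub>Gal N \<rat>\<^esub> \<sigma> = \<iota>" "\<sigma>\<^sub>2 \<otimes>\<^bsub>Gal N \<rat>\<^esub> \<sigma>\<^sub>2 = \<sigma>"
proof -
  show "\<sigma> \<otimes>\<^bsub>Gal N \<rat>\<^esub> \<sigma>\<^sub>2 = \<iota>"
    by (rule Gal_eqI[of _ \<rat> _ \<rat>])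
       (simp_all add: \<sigma>(1) \<sigma>\<^sub>2_carrier Gal_mult_apply Gal_one_apply \<alpha>_in_N z_in_N \<sigma>\<^sub>2_values \<sigma> \<sigma>_z)
  then show "\<sigma>\<^sub>2 \<otimes>\<^bsub>Gal N \<rat>\<^esub> \<sigma> = \<iota>" "\<sigma>\<^sub>2 \<otimes>\<^bsub>Gal N \<rat>\<^esub> \<sigma>\<^sub>2 = \<sigma>"
    using \<sigma>(1) by (simp_all add: \<sigma>\<^sub>2 G.m_assoc)
qed

lemma distinct_powers: "\<iota> \<noteq> \<sigma>" "\<iota> \<noteq> \<sigma>\<^sub>2" "\<sigma> \<noteq> \<sigma>\<^sub>2"
  using Gal_one_apply[OF \<alpha>_in_N, of \<rat>] \<sigma>(2) \<sigma>\<^sub>2_values(1) distinct_roots by metis+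

lemma generate_\<sigma>: "generate (Gal N \<rat>) {\<sigma>} = {\<iota>, \<sigma>, \<sigma>\<^sub>2}"
proof (rule G.generateI[symmetric])
  have "inv\<^bsub>Gal N \<rat>\<^esub> \<sigma> = \<sigma>\<^sub>2" "inv\<^bsub>Gal N \<rat>\<^esub> \<sigma>\<^sub>2 = \<sigma>"
    using G.inv_equality \<sigma>_cubed \<sigma>(1) \<sigma>\<^sub>2_carrier by auto
  then show "subgroup {\<iota>, \<sigma>, \<sigma>\<^sub>2} (Gal N \<rat>)"
    by unfold_locales (auto simp: \<sigma>(1) \<sigma>\<^sub>2_carrier \<sigma>_cubed simp flip: \<sigma>\<^sub>2)
  show "{\<iota>, \<sigma>, \<sigma>\<^sub>2} \<subseteq> K" if "subgroup K (Gal N \<rat>)" "{\<sigma>} \<subseteq> K" for K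
    using that subgroup.one_closed[OF that(1)] subgroup.m_closed[OF that(1), of \<sigma> \<sigma>] by (simp add: \<sigma>\<^sub>2)
qed simp

text \<open>An automorphism fixing \<alpha> either fixes the other two roots or exchanges them. The
  conjugation rules are equalities of automorphisms and need checking only at \<alpha> and
  z.\<close>

lemma Gal_L_cases:
  assumes "\<tau> \<in> carrier (Gal N (rat_adjoin {\<alpha>}))"
  shows "\<tau> = \<iota> \<or> (\<tau> z = - z \<and> inv\<^bsub>Gal N \<rat>\<^esub> \<tau> \<in> carrier (Gal N \<rat>) \<and>
    \<tau> \<otimes>\<^bsub>Gal N \<rat>\<^esub> \<sigma> \<otimes>\<^bsub>Gal N \<rat>\<^esub> inv\<^bsub>Gal N \<rat>\<^esub> \<tau> = \<sigma>\<^sub>2 \<and>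
    \<tau> \<otimes>\<^bsub>Gal N \<rat>\<^esub> \<sigma>\<^sub>2 \<otimes>\<^bsub>Gal N \<rat>\<^esub> inv\<^bsub>Gal N \<rat>\<^esub> \<tau> = \<sigma>)"
proof -
  have \<tau>: "\<tau> \<in> carrier (Gal N \<rat>)"
    using assms Gal_mono[of \<rat> "rat_adjoin {\<alpha>}"] subfield_ambD(8)[OF subfield_rat_adjoin]
    by (auto simp: Rats_def)
  have fix_\<alpha>: "\<tau> \<alpha> = \<alpha>" using Gal_hom(10)[OF assms] rat_adjoin_incl[of "{\<alpha>}"] by blast
  show ?thesis
  proof (cases "\<tau> \<alpha>\<^sub>2 = \<alpha>\<^sub>2")
    case True
    have "\<tau> = \<iota>"
      by (rule Gal_eqI[OF \<tau> G.one_closed])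
         (simp_all add: fix_\<alpha> Gal_z(1)[OF \<tau> fix_\<alpha> True] Gal_one_apply \<alpha>_in_N z_in_N)
    then show ?thesis ..
  next
    case False
    then have \<alpha>\<^sub>2: "\<tau> \<alpha>\<^sub>2 = \<alpha>\<^sub>3" using Gal_z(5)[OF \<tau> fix_\<alpha>] by blast
    note z = Gal_z(2)[OF \<tau> fix_\<alpha> \<alpha>\<^sub>2]
    have c: "inv\<^bsub>Gal N \<rat>\<^esub> \<tau> \<in> carrier (Gal N \<rat>)" using \<tau> by simp
    have "\<tau> \<otimes>\<^bsub>Gal N \<rat>\<^esub> \<sigma> = \<sigma>\<^sub>2 \<otimes>\<^bsub>Gal N \<rat>\<^esub> \<tau>"
      by (rule Gal_eqI[of _ \<rat> _ \<rat>])
         (simp_all add: \<tau> \<sigma>(1) \<sigma>\<^sub>2_carrier Gal_mult_apply \<alpha>_in_N z_in_N \<sigma>\<^sub>2_values \<sigma> \<sigma>_z z fix_\<alpha> \<alpha>\<^sub>2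
            Gal_hom(6)[OF \<sigma>\<^sub>2_carrier])
    moreover have "\<tau> \<otimes>\<^bsub>Gal N \<rat>\<^esub> \<sigma>\<^sub>2 = \<sigma> \<otimes>\<^bsub>Gal N \<rat>\<^esub> \<tau>"
      by (rule Gal_eqI[of _ \<rat> _ \<rat>])
         (simp_all add: \<tau> \<sigma>(1) \<sigma>\<^sub>2_carrier Gal_mult_apply \<alpha>_in_N z_in_N \<sigma>\<^sub>2_values \<sigma> \<sigma>_z z fix_\<alpha>
            Gal_z(4)[OF \<tau> fix_\<alpha> \<alpha>\<^sub>2] Gal_hom(6)[OF \<sigma>(1)])
    ultimately show ?thesis using \<tau> \<sigma>(1) \<sigma>\<^sub>2_carrier z c by (simp add: G.m_assoc)
  qed
qed

text \<open>If z = u(\<alpha>), then u takes the value z at all three roots because \<sigma> fixes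
  z; the trace 3 z is rational.\<close>

lemma z_in_adjoin_imp_Rats:
  assumes "z \<in> rat_adjoin {\<alpha>}"
  shows "z \<in> \<rat>"
proof -
  obtain u where u: "quad_on_roots a b u" "z = u \<alpha>" using assms unfolding rat_adjoin_\<alpha> by blast
  have "u \<alpha>\<^sub>2 = z" "u \<alpha>\<^sub>3 = z"
    using Gal_quad_on_roots[OF \<sigma>(1) _ u(1), of \<alpha>] Gal_quad_on_roots[OF \<sigma>\<^sub>2_carrier _ u(1), of \<alpha>] u(2) \<sigma>_z \<sigma>\<^sub>2_values \<sigma>(2)
    by simp_all
  then have "3 * z \<in> \<rat>" using trace_Rats[OF u(1)] u(2) by simp
  then have "3 * z / 3 \<in> \<rat>" by (rule Rats_divide) simp
  then show ?thesis by simp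
qed

text \<open>For irrational z, which then lies outside L, the elements 1 and z are independent over
  L, so F(\<alpha>, z) -> F(\<alpha>, -z) does not depend on the choice of F. The map is its own
  inverse, which gives bijectivity.\<close>

lemma conjugation_exists:
  assumes "z \<notin> \<rat>"
  obtains \<tau> where "\<tau> \<in> carrier (Gal N (rat_adjoin {\<alpha>}))" "\<tau> z = - z"
proof -
  have mz: "(- z) ^ 2 = of_int (4 * a ^ 3 - 27 * b ^ 2)" using z_sq by simp
  have zero: "F \<alpha> (- z) = 0" if assm: "quad_on_conj a b F" "F \<alpha> z = 0" for F
  proof -
    obtain u v where F: "quad_on_roots a b u" "quad_on_roots a b v"
      "\<And>x s. x ^ 3 - of_int a * x + of_int b = 0 \<Longrightarrow> s ^ 2 = of_int (4 * a ^ 3 - 27 * b ^ 2) \<Longrightarrow> F x s = u x + v x * s"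
      using assm(1) unfolding quad_on_conj_def by blast
    have eq: "u \<alpha> + v \<alpha> * z = 0" using F(3)[OF root z_sq] assm(2) by simp
    have uv: "u \<alpha> \<in> rat_adjoin {\<alpha>}" "v \<alpha> \<in> rat_adjoin {\<alpha>}" using F(1,2) unfolding rat_adjoin_\<alpha> by blast+
    have "v \<alpha> = 0"
    proof (rule ccontr)
      assume "v \<alpha> \<noteq> 0"
      then have "z = - u \<alpha> / v \<alpha>" using eq by (simp add: field_simps eq_neg_iff_add_eq_0)
      then have "z \<in> rat_adjoin {\<alpha>}" using uv by (simp add: subfield_ambD[OF subfield_rat_adjoin])
      then show False using assms z_in_adjoin_imp_Rats by blast
    qed
    then show ?thesis using eq F(3)[OF root mz] by simp
  qed
  have well_def: "F \<alpha> (- z) = F' \<alpha> (- z)" if assm: "quad_on_conj a b F" "quad_on_conj a b F'" "F \<alpha> z = F' \<alpha> z" for F F'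
    \<comment> \<open>The vanishing statement is applied to F - F'.\<close>
    using zero[OF quad_on_conj_add[OF assm(1) quad_on_conj_mult[OF quad_on_conj_quad_on_roots[OF quad_on_roots_const[of a b "-1"]] assm(2)]]] assm(3) by simp
  define \<tau> where "\<tau> = (\<lambda>x\<in>N. (SOME F. quad_on_conj a b F \<and> x = F \<alpha> z) \<alpha> (- z))"
  have \<tau>: "\<tau> (F \<alpha> z) = F \<alpha> (- z)" if assm: "quad_on_conj a b F" for F
  proof -
    have N: "F \<alpha> z \<in> N" unfolding N_eq using assm by blast
    define F' where "F' = (SOME F'. quad_on_conj a b F' \<and> F \<alpha> z = F' \<alpha> z)"
    have F': "quad_on_conj a b F' \<and> F \<alpha> z = F' \<alpha> z"
      unfolding F'_def by (rule someI[of _ F]) (simp add: assm)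
    have "\<tau> (F \<alpha> z) = F' \<alpha> (- z)" using N by (simp add: \<tau>_def F'_def)
    then show ?thesis using well_def[OF assm, of F'] F' by simp
  qed
  have mem: "F \<alpha> z \<in> N" if assm: "quad_on_conj a b F" for F unfolding N_eq using assm by blast
  have conj: "F \<alpha> (- z) \<in> N" "\<tau> (F \<alpha> (- z)) = F \<alpha> z" if assm: "quad_on_conj a b F" for F
    using mem[OF quad_on_conj_conj[OF assm]] \<tau>[OF quad_on_conj_conj[OF assm]] by simp_all
  have invol: "\<tau> x \<in> N \<and> \<tau> (\<tau> x) = x" if assm: "x \<in> N" for x
    using assm \<tau> conj unfolding N_eq by fastforce
  have "\<tau> \<in> carrier (Gal N (rat_adjoin {\<alpha>}))" unfolding Gal_iff
  proof (intro conjI ballI)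
    have "bij_betw \<tau> N N" by (rule bij_betw_byWitness[where f' = \<tau>]) (use invol in auto)
    then show "\<tau> \<in> Bij N" by (auto simp: Bij_def \<tau>_def)
    show "\<tau> (x + y) = \<tau> x + \<tau> y" "\<tau> (x * y) = \<tau> x * \<tau> y" if xy: "x \<in> N" "y \<in> N" for x y
    proof -
      obtain F F' where F: "quad_on_conj a b F" "x = F \<alpha> z" "quad_on_conj a b F'" "y = F' \<alpha> z"
        using xy unfolding N_eq by blast
      show "\<tau> (x + y) = \<tau> x + \<tau> y" "\<tau> (x * y) = \<tau> x * \<tau> y"
        using \<tau>[OF quad_on_conj_add[OF F(1,3)]] \<tau>[OF quad_on_conj_mult[OF F(1,3)]] \<tau>[OF F(1)] \<tau>[OF F(3)] F(2,4) by simp_all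
    qed
    show "\<tau> 1 = 1" using \<tau>[OF quad_on_conj_quad_on_roots[OF quad_on_roots_const[of a b 1]]] by simp
    show "\<tau> x = x" if assm: "x \<in> rat_adjoin {\<alpha>}" for x
      using assm \<tau>[OF quad_on_conj_quad_on_roots] unfolding rat_adjoin_\<alpha> by auto
  qed
  moreover have "\<tau> z = - z" using \<tau>[OF quad_on_conj_snd] by simp
  ultimately show ?thesis by (rule that)
qed

section \<open>Coordinates on the Hopf algebra\<close>

lemma rat_adjoin_z: "rat_adjoin {z} = {of_rat p + of_rat q * z | p q. True}"
proof
  let ?K = "{of_rat p + of_rat q * z | p q. True}"
  have sub: "?K \<subseteq> K" if "subfield K amb" "z \<in> K" for K
    using that(2) by (auto simp: subfield_ambD[OF that(1)])
  have "subfield ?K amb"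
  proof (rule algebraic_rat_algebra_subfield)
    show "of_rat q \<in> ?K" for q unfolding mem_Collect_eq by (rule exI[of _ q], rule exI[of _ 0]) simp
    fix x y assume "x \<in> ?K"
    then obtain p q where x: "x = of_rat p + of_rat q * z" by blast
    show "algebraic x" using sub[OF subfield_N z_in_N] \<open>x \<in> ?K\<close> algebraic_N by blast
    assume "y \<in> ?K"
    then obtain p' q' where y: "y = of_rat p' + of_rat q' * z" by blast
    have "x + y = of_rat (p + p') + of_rat (q + q') * z"
      by (simp add: x y of_rat_add algebra_simps)
    then show "x + y \<in> ?K" by blast
    have "x * y = of_rat p * of_rat p' + of_rat q * of_rat q' * z ^ 2 + (of_rat p * of_rat q' + of_rat q * of_rat p') * z"
      by (simp add: x y power2_eq_square algebra_simps)
    also have "\<dots> = of_rat (p * p' + q * q' * of_int (4 * a ^ 3 - 27 * b ^ 2)) + of_rat (p * q' + q * p') * z"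
      unfolding z_sq of_rat_add of_rat_mult of_rat_of_int_eq ..
    finally show "x * y \<in> ?K" by blast
  qed
  then show "rat_adjoin {z} \<subseteq> ?K"
    by (rule rat_adjoin_minimal) (auto intro: exI[of _ "0::rat"] exI[of _ "1::rat"])
  show "?K \<subseteq> rat_adjoin {z}" using sub[OF subfield_rat_adjoin] rat_adjoin_incl by blast
qed

text \<open>This is x w_1 + y w_2 + t w_3, written out in the group elements of J.\<close>

definition hopf_elem :: "rat \<Rightarrow> rat \<Rightarrow> rat \<Rightarrow> ('a \<Rightarrow> 'a) \<Rightarrow>\<^sub>0 'a" where
  "hopf_elem x y t = Poly_Mapping.single \<iota> (of_rat x) + Poly_Mapping.single \<sigma> (of_rat t + of_rat y * z)
     + Poly_Mapping.single \<sigma>\<^sub>2 (of_rat t - of_rat y * z)"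

lemma lookup_hopf_elem [simp]:
  "Poly_Mapping.lookup (hopf_elem x y t) \<iota> = of_rat x"
  "Poly_Mapping.lookup (hopf_elem x y t) \<sigma> = of_rat t + of_rat y * z"
  "Poly_Mapping.lookup (hopf_elem x y t) \<sigma>\<^sub>2 = of_rat t - of_rat y * z"
  "j \<notin> {\<iota>, \<sigma>, \<sigma>\<^sub>2} \<Longrightarrow> Poly_Mapping.lookup (hopf_elem x y t) j = 0"
  using distinct_powers by (auto simp: hopf_elem_def lookup_add lookup_single when_def)

lemma eq_hopf_elemI:
  assumes "Poly_Mapping.keys h \<subseteq> {\<iota>, \<sigma>, \<sigma>\<^sub>2}" "Poly_Mapping.lookup h \<iota> = of_rat x"
    "Poly_Mapping.lookup h \<sigma> = of_rat t + of_rat y * z" "Poly_Mapping.lookup h \<sigma>\<^sub>2 = of_rat t - of_rat y * z"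
  shows "h = hopf_elem x y t"
proof (rule poly_mapping_eqI)
  fix j
  show "Poly_Mapping.lookup h j = Poly_Mapping.lookup (hopf_elem x y t) j"
  proof (cases "j \<in> {\<iota>, \<sigma>, \<sigma>\<^sub>2}")
    case True
    then show ?thesis using assms(2-) by auto
  next
    case False
    then show ?thesis using assms(1) by (metis lookup_hopf_elem(4) in_keys_iff subsetD)
  qed
qed

lemma keys_hopf_elem: "Poly_Mapping.keys (hopf_elem x y t) \<subseteq> {\<iota>, \<sigma>, \<sigma>\<^sub>2}"
proof
  fix j assume "j \<in> Poly_Mapping.keys (hopf_elem x y t)"
  then have "Poly_Mapping.lookup (hopf_elem x y t) j \<noteq> 0" by (simp add: in_keys_iff)
  then show "j \<in> {\<iota>, \<sigma>, \<sigma>\<^sub>2}" using lookup_hopf_elem(4) by blast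
qed

lemma hopf_elem_add: "hopf_elem x y t + hopf_elem x' y' t' = hopf_elem (x + x') (y + y') (t + t')"
proof (rule eq_hopf_elemI)
  show "Poly_Mapping.keys (hopf_elem x y t + hopf_elem x' y' t') \<subseteq> {\<iota>, \<sigma>, \<sigma>\<^sub>2}"
    using keys_add[of "hopf_elem x y t" "hopf_elem x' y' t'"] keys_hopf_elem by blast
qed (simp_all add: lookup_add of_rat_add algebra_simps)

lemma cscale_hopf_elem: "cscale (of_rat q) (hopf_elem x y t) = hopf_elem (q * x) (q * y) (q * t)"
  by (simp add: hopf_elem_def cscale_add cscale_single of_rat_mult algebra_simps)

lemma zscale_hopf_elem: "zscale n (hopf_elem x y t) = hopf_elem (of_int n * x) (of_int n * y) (of_int n * t)"
  using cscale_hopf_elem[of "of_int n"] by (simp add: zscale_def)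

text \<open>Adding the coefficients at \<sigma> and at its square isolates t, and then y follows
  from z being nonzero. The argument therefore covers rational z as well.\<close>

lemma hopf_elem_eq_iff: "hopf_elem x y t = hopf_elem x' y' t' \<longleftrightarrow> x = x' \<and> y = y' \<and> t = t'"
proof
  assume eq: "hopf_elem x y t = hopf_elem x' y' t'"
  have 1: "of_rat x = (of_rat x' :: 'a)"
    using arg_cong[OF eq, of "\<lambda>h. Poly_Mapping.lookup h \<iota>"] by simp
  have 2: "of_rat t + of_rat y * z = of_rat t' + of_rat y' * z"
    using arg_cong[OF eq, of "\<lambda>h. Poly_Mapping.lookup h \<sigma>"] by simp
  have 3: "of_rat t - of_rat y * z = of_rat t' - of_rat y' * z"
    using arg_cong[OF eq, of "\<lambda>h. Poly_Mapping.lookup h \<sigma>\<^sub>2"] by simp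
  have "2 * of_rat t = (2 * of_rat t' :: 'a)" using arg_cong2[OF 2 3, of "(+)"] by simp
  then have t: "t = t'" by simp
  then have "of_rat y = (of_rat y' :: 'a)" using 2 z_nonzero by simp
  then show "x = x' \<and> y = y' \<and> t = t'" using 1 t by simp
qed simp

text \<open>Extends the sum from the support of h to all of J; the added terms vanish because \<tau>
  0 = 0.\<close>

lemma galois_act_expand:
  assumes "Poly_Mapping.keys h \<subseteq> {\<iota>, \<sigma>, \<sigma>\<^sub>2}" "\<tau> \<in> carrier (Gal N K)"
  shows "galois_act (Gal N \<rat>) \<tau> h =
    (\<Sum>j\<in>{\<iota>, \<sigma>, \<sigma>\<^sub>2}. Poly_Mapping.single (\<tau> \<otimes>\<^bsub>Gal N \<rat>\<^esub> j \<otimes>\<^bsub>Gal N \<rat>\<^esub> inv\<^bsub>Gal N \<rat>\<^esub> \<tau>) (\<tau> (Poly_Mapping.lookup h j)))"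
  unfolding galois_act_def
  by (rule sum.mono_neutral_left)
     (use assms Gal_hom(5)[OF assms(2), of 0] in \<open>auto simp: in_keys_iff\<close>)

lemma Gal_L_subset: "carrier (Gal N (rat_adjoin {\<alpha>})) \<subseteq> carrier (Gal N \<rat>)"
  by (rule Gal_mono) (use subfield_ambD(8)[OF subfield_rat_adjoin] in \<open>auto simp: Rats_def\<close>)

lemma galois_act_swap:
  assumes "Poly_Mapping.keys h \<subseteq> {\<iota>, \<sigma>, \<sigma>\<^sub>2}" "\<tau> \<in> carrier (Gal N (rat_adjoin {\<alpha>}))" "\<tau> z = - z"
  shows "galois_act (Gal N \<rat>) \<tau> h = Poly_Mapping.single \<iota> (\<tau> (Poly_Mapping.lookup h \<iota>))
    + Poly_Mapping.single \<sigma>\<^sub>2 (\<tau> (Poly_Mapping.lookup h \<sigma>)) + Poly_Mapping.single \<sigma> (\<tau> (Poly_Mapping.lookup h \<sigma>\<^sub>2))"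
proof -
  have "z \<noteq> - z"
  proof
    assume "z = - z"
    then have "2 * z = 0" unfolding mult_2 by (rule eq_neg_iff_add_eq_0[THEN iffD1])
    then show False using z_nonzero by simp
  qed
  then have "\<tau> \<noteq> \<iota>" using assms(3) Gal_one_apply[OF z_in_N] by auto
  then have conj: "\<tau> \<otimes>\<^bsub>Gal N \<rat>\<^esub> \<sigma> \<otimes>\<^bsub>Gal N \<rat>\<^esub> inv\<^bsub>Gal N \<rat>\<^esub> \<tau> = \<sigma>\<^sub>2"
    "\<tau> \<otimes>\<^bsub>Gal N \<rat>\<^esub> \<sigma>\<^sub>2 \<otimes>\<^bsub>Gal N \<rat>\<^esub> inv\<^bsub>Gal N \<rat>\<^esub> \<tau> = \<sigma>"
    using Gal_L_cases[OF assms(2)] by blast+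
  have "\<tau> \<in> carrier (Gal N \<rat>)" using assms(2) Gal_L_subset by blast
  then have conj_one: "\<tau> \<otimes>\<^bsub>Gal N \<rat>\<^esub> \<iota> \<otimes>\<^bsub>Gal N \<rat>\<^esub> inv\<^bsub>Gal N \<rat>\<^esub> \<tau> = \<iota>" by simp
  have "(\<Sum>j\<in>{\<iota>, \<sigma>, \<sigma>\<^sub>2}. F j) = F \<iota> + F \<sigma> + F \<sigma>\<^sub>2" for F :: "_ \<Rightarrow> ('a \<Rightarrow> 'a) \<Rightarrow>\<^sub>0 'a"
    using distinct_powers by (simp add: add.assoc)
  then show ?thesis by (simp only: galois_act_expand[OF assms(1,2)] conj conj_one)
qed

lemma Gal_apply_Qz:
  assumes "\<tau> \<in> carrier (Gal N K)"
  shows "\<tau> (of_rat p + of_rat q * z) = of_rat p + of_rat q * \<tau> z"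
    "\<tau> (of_rat p - of_rat q * z) = of_rat p - of_rat q * \<tau> z"
  by (simp_all add: Gal_hom[OF assms] N_closed z_in_N)

text \<open>For rational z the three coefficients are arbitrary rationals and y, t are found by
  solving two linear equations. For irrational z, invariance under z -> -z makes the coefficient at
  the identity rational and the other two conjugate.\<close>

lemma hopf_galois_eq:
  "hopf_galois N (rat_adjoin {\<alpha>}) (rat_adjoin {z}) \<sigma> = {hopf_elem x y t | x y t. True}"
proof (intro equalityI subsetI)
  fix h assume "h \<in> hopf_galois N (rat_adjoin {\<alpha>}) (rat_adjoin {z}) \<sigma>"
  then have keys: "Poly_Mapping.keys h \<subseteq> {\<iota>, \<sigma>, \<sigma>\<^sub>2}"
    and coeffs: "\<And>j. j \<in> {\<iota>, \<sigma>, \<sigma>\<^sub>2} \<Longrightarrow> \<exists>p q. Poly_Mapping.lookup h j = of_rat p + of_rat q * z"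
    and inv: "\<And>\<tau>. \<tau> \<in> carrier (Gal N (rat_adjoin {\<alpha>})) \<Longrightarrow> galois_act (Gal N \<rat>) \<tau> h = h"
    unfolding hopf_galois_def group_ring_def generate_\<sigma> rat_adjoin_z by blast+
  obtain p0 q0 p1 q1 p2 q2 where h: "Poly_Mapping.lookup h \<iota> = of_rat p0 + of_rat q0 * z"
    "Poly_Mapping.lookup h \<sigma> = of_rat p1 + of_rat q1 * z" "Poly_Mapping.lookup h \<sigma>\<^sub>2 = of_rat p2 + of_rat q2 * z"
    using coeffs by (metis insertCI)
  have "\<exists>x y t. h = hopf_elem x y t"
  proof (cases "z \<in> \<rat>")
    case True
    then obtain r where r: "z = of_rat r" by (auto simp: Rats_def)
    then have r0: "r \<noteq> 0" using z_nonzero by auto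
    define t y where "t = ((p1 + q1 * r) + (p2 + q2 * r)) / 2" and "y = ((p1 + q1 * r) - (p2 + q2 * r)) / (2 * r)"
    have ty: "p1 + q1 * r = t + y * r" "p2 + q2 * r = t - y * r"
      using r0 by (simp_all add: t_def y_def field_simps)
    have "of_rat p + of_rat q * z = of_rat (p + q * r)" "of_rat p - of_rat q * z = of_rat (p - q * r)" for p q
      by (simp_all add: r of_rat_add of_rat_mult of_rat_diff)
    then have "h = hopf_elem (p0 + q0 * r) y t"
      by (intro eq_hopf_elemI[OF keys]) (simp_all only: h ty)
    then show ?thesis by blast
  next
    case False
    then obtain \<tau> where \<tau>: "\<tau> \<in> carrier (Gal N (rat_adjoin {\<alpha>}))" "\<tau> z = - z"
      by (rule conjugation_exists)
    have eq: "Poly_Mapping.single \<iota> (of_rat p0 - of_rat q0 * z) + Poly_Mapping.single \<sigma>\<^sub>2 (of_rat p1 - of_rat q1 * z)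
        + Poly_Mapping.single \<sigma> (of_rat p2 - of_rat q2 * z) = h"
      using inv[OF \<tau>(1)] unfolding galois_act_swap[OF keys \<tau>] h Gal_apply_Qz[OF \<tau>(1)] \<tau>(2) by simp
    have 0: "of_rat p0 - of_rat q0 * z = of_rat p0 + of_rat q0 * z"
      using arg_cong[OF eq, of "\<lambda>h. Poly_Mapping.lookup h \<iota>"] h(1) distinct_powers
      by (simp add: lookup_add lookup_single when_def)
    then have "2 * (of_rat q0 * z) = 0" by (simp add: algebra_simps)
    then have "q0 = 0" using z_nonzero by simp
    moreover have "of_rat p2 - of_rat q2 * z = of_rat p1 + of_rat q1 * z"
      using arg_cong[OF eq, of "\<lambda>h. Poly_Mapping.lookup h \<sigma>"] h(2) distinct_powers
      by (simp add: lookup_add lookup_single when_def)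
    ultimately have "h = hopf_elem p0 (- q2) p2"
      by (intro eq_hopf_elemI[OF keys]) (simp_all add: h of_rat_minus)
    then show ?thesis by blast
  qed
  then show "h \<in> {hopf_elem x y t | x y t. True}" by blast
next
  fix h assume "h \<in> {hopf_elem x y t | x y t. True}"
  then obtain x y t where h: "h = hopf_elem x y t" by blast
  have "Poly_Mapping.lookup h j \<in> rat_adjoin {z}" if "j \<in> {\<iota>, \<sigma>, \<sigma>\<^sub>2}" for j
    using that rat_adjoin_incl[of "{z}"]
    by (auto simp: h subfield_ambD[OF subfield_rat_adjoin])
  moreover have "galois_act (Gal N \<rat>) \<tau> h = h" if \<tau>: "\<tau> \<in> carrier (Gal N (rat_adjoin {\<alpha>}))" for \<tau>
  proof (cases "\<tau> z = - z")
    case True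
    show ?thesis
      using True by (simp add: galois_act_swap[OF _ \<tau> True] h keys_hopf_elem Gal_apply_Qz[OF \<tau>] Gal_hom(4)[OF \<tau>])
        (simp add: hopf_elem_def add_ac)
  next
    case False
    then have \<iota>: "\<tau> = \<iota>" using Gal_L_cases[OF \<tau>] by blast
    \<comment> \<open>The neutral element acts as the identity only on N and is
      \<open>undefined\<close> elsewhere.\<close>
    have in_N: "of_rat x \<in> N" "of_rat t + of_rat y * z \<in> N" "of_rat t - of_rat y * z \<in> N"
      by (simp_all add: N_closed z_in_N)
    show ?thesis unfolding galois_act_expand[OF keys_hopf_elem \<tau>, of x y t, folded h] unfolding \<iota>
      using distinct_powers \<sigma>(1) \<sigma>\<^sub>2_carrier
      by (simp add: h Gal_one_apply in_N G.inv_one) (simp add: hopf_elem_def add_ac)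
  qed
  ultimately show "h \<in> hopf_galois N (rat_adjoin {\<alpha>}) (rat_adjoin {z}) \<sigma>"
    using keys_hopf_elem[of x y t] unfolding hopf_galois_def group_ring_def generate_\<sigma> h by blast
qed

section \<open>The action on Z[\<alpha>]\<close>

lemma hopf_act_hopf_elem:
  assumes "\<beta> \<in> N"
  shows "hopf_act (hopf_elem x y t) \<beta> = of_rat x * \<beta> + of_rat t * (\<sigma> \<beta> + \<sigma>\<^sub>2 \<beta>) + of_rat y * (z * (\<sigma> \<beta> - \<sigma>\<^sub>2 \<beta>))"
proof -
  have "hopf_act (hopf_elem x y t) \<beta> = (\<Sum>j\<in>{\<iota>, \<sigma>, \<sigma>\<^sub>2}. Poly_Mapping.lookup (hopf_elem x y t) j * j \<beta>)"
    unfolding hopf_act_def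
    by (rule sum.mono_neutral_left) (use keys_hopf_elem in \<open>auto simp: in_keys_iff simp del: lookup_hopf_elem\<close>)
  then show ?thesis using distinct_powers assms by (simp add: Gal_one_apply algebra_simps)
qed

lemma hopf_act_add:
  assumes "\<beta> \<in> N" "\<gamma> \<in> N"
  shows "hopf_act (hopf_elem x y t) (\<beta> + \<gamma>) = hopf_act (hopf_elem x y t) \<beta> + hopf_act (hopf_elem x y t) \<gamma>"
  using assms
  by (simp add: hopf_act_hopf_elem N_closed Gal_hom(2)[OF \<sigma>(1)] Gal_hom(2)[OF \<sigma>\<^sub>2_carrier] algebra_simps)

lemma hopf_act_of_int_mult:
  assumes "\<beta> \<in> N"
  shows "hopf_act (hopf_elem x y t) (of_int n * \<beta>) = of_int n * hopf_act (hopf_elem x y t) \<beta>"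
  using assms
  by (simp add: hopf_act_hopf_elem N_closed Gal_hom(3,5)[OF \<sigma>(1)] Gal_hom(3,5)[OF \<sigma>\<^sub>2_carrier] algebra_simps)

lemma int_adjoin_\<alpha>:
  "int_adjoin \<alpha> = {of_int k0 + of_int k1 * \<alpha> + of_int k2 * \<alpha> ^ 2 | k0 k1 k2. True}"
proof (intro equalityI subsetI)
  fix x assume "x \<in> int_adjoin \<alpha>"
  then obtain p where "x = poly (map_poly of_int p) \<alpha>" by (auto simp: int_adjoin_def)
  moreover have "\<exists>k0 k1 k2. poly (map_poly of_int p) \<alpha> = of_int k0 + of_int k1 * \<alpha> + of_int k2 * \<alpha> ^ 2"
  proof (induction p)
    case 0
    show ?case by (rule exI[of _ 0], rule exI[of _ 0], rule exI[of _ 0]) simp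
  next
    case (pCons c p)
    then obtain k0 k1 k2 where k: "poly (map_poly of_int p) \<alpha> = of_int k0 + of_int k1 * \<alpha> + of_int k2 * \<alpha> ^ 2"
      by blast
    \<comment> \<open>One Horner step: \<alpha>^3 = a \<alpha> - b keeps the coefficients integral
      because the cubic is monic.\<close>
    have step: "C + \<alpha> * (K0 + K1 * \<alpha> + K2 * \<alpha> ^ 2) = (C - K2 * B) + (K0 + K2 * A) * \<alpha> + K1 * \<alpha> ^ 2"
      if "\<alpha> ^ 3 - A * \<alpha> + B = 0" for C K0 K1 K2 A B
      using that by Groebner_Basis.algebra
    show ?case
      by (rule exI[of _ "c - k2 * b"], rule exI[of _ "k0 + k2 * a"], rule exI[of _ k1])
         (simp add: map_poly_pCons k step[OF root])
  qed
  ultimately show "x \<in> {of_int k0 + of_int k1 * \<alpha> + of_int k2 * \<alpha> ^ 2 | k0 k1 k2. True}" by blast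
next
  fix x assume "x \<in> {of_int k0 + of_int k1 * \<alpha> + of_int k2 * \<alpha> ^ 2 | k0 k1 k2. True}"
  then obtain k0 k1 k2 where "x = poly (map_poly of_int [:k0, k1, k2:]) \<alpha>"
    by (auto simp: map_poly_pCons power2_eq_square algebra_simps)
  then show "x \<in> int_adjoin \<alpha>" unfolding int_adjoin_def by blast
qed

lemma in_int_adjoin_iff:
  "of_rat r0 + of_rat r1 * \<alpha> + of_rat r2 * \<alpha> ^ 2 \<in> int_adjoin \<alpha> \<longleftrightarrow> r0 \<in> \<int> \<and> r1 \<in> \<int> \<and> r2 \<in> \<int>"
proof
  assume "of_rat r0 + of_rat r1 * \<alpha> + of_rat r2 * \<alpha> ^ 2 \<in> int_adjoin \<alpha>"
  then obtain k0 k1 k2 where "of_rat r0 + of_rat r1 * \<alpha> + of_rat r2 * \<alpha> ^ 2 = of_int k0 + of_int k1 * \<alpha> + of_int k2 * \<alpha> ^ 2"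
    unfolding int_adjoin_\<alpha> by blast
  then have "of_rat (r0 - of_int k0) + of_rat (r1 - of_int k1) * \<alpha> + of_rat (r2 - of_int k2) * \<alpha> ^ 2 = 0"
    by (simp add: of_rat_diff algebra_simps)
  from linear_independent[OF this] show "r0 \<in> \<int> \<and> r1 \<in> \<int> \<and> r2 \<in> \<int>" by simp
next
  assume "r0 \<in> \<int> \<and> r1 \<in> \<int> \<and> r2 \<in> \<int>"
  then obtain k0 k1 k2 where "r0 = of_int k0" "r1 = of_int k1" "r2 = of_int k2" by (metis Ints_cases)
  then show "of_rat r0 + of_rat r1 * \<alpha> + of_rat r2 * \<alpha> ^ 2 \<in> int_adjoin \<alpha>"
    unfolding int_adjoin_\<alpha> by auto
qed

section \<open>The associated order\<close>

lemma assoc_order_eq: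
  assumes "g = gcd a b" "\<not> 3 dvd a"
  shows "assoc_order (hopf_galois N (rat_adjoin {\<alpha>}) (rat_adjoin {z}) \<sigma>) (int_adjoin \<alpha>)
    = {hopf_elem (of_int k) (of_int m / (2 * of_int g)) (of_int n / 2) | k m n. even (n - b div g * m)}"
proof -
  obtain \<epsilon> :: int where \<epsilon>: "\<epsilon> = 1 \<or> \<epsilon> = - 1" "z = of_int \<epsilon> * ((3 * \<alpha> ^ 2 - of_int a) * (\<alpha>\<^sub>2 - \<alpha>\<^sub>3))"
    using obtain_sign by metis
  have one_N: "1 \<in> N" and \<alpha>2_N: "\<alpha> ^ 2 \<in> N" using N_closed \<alpha>_in_N by (simp_all add: power2_eq_square)
  have z_diff: "z * (\<alpha>\<^sub>2 - \<alpha>\<^sub>3) = of_int \<epsilon> * (- 4 * of_int a ^ 2 + 9 * of_int b * \<alpha> + 6 * of_int a * \<alpha> ^ 2)"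
    "z * (\<alpha>\<^sub>2 ^ 2 - \<alpha>\<^sub>3 ^ 2) = of_int \<epsilon> * (6 * of_int a * of_int b - 2 * of_int a ^ 2 * \<alpha> - 9 * of_int b * \<alpha> ^ 2)"
    and sum_sq: "\<alpha>\<^sub>2 ^ 2 + \<alpha>\<^sub>3 ^ 2 = 2 * of_int a - \<alpha> ^ 2"
  proof -
    have "Z * (x - y) = E * (- 4 * A ^ 2 + 9 * B * \<alpha> + 6 * A * \<alpha> ^ 2)"
      "Z * (x ^ 2 - y ^ 2) = E * (6 * A * B - 2 * A ^ 2 * \<alpha> - 9 * B * \<alpha> ^ 2)"
      "x ^ 2 + y ^ 2 = 2 * A - \<alpha> ^ 2"
      if "x + y = - \<alpha>" "x * y = \<alpha> ^ 2 - A" "B = \<alpha> * A - \<alpha> ^ 3" "Z = E * ((3 * \<alpha> ^ 2 - A) * (x - y))" for x y A B E Z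
      using that by Groebner_Basis.algebra+
    note this[OF vieta \<epsilon>(2)]
    then show "z * (\<alpha>\<^sub>2 - \<alpha>\<^sub>3) = of_int \<epsilon> * (- 4 * of_int a ^ 2 + 9 * of_int b * \<alpha> + 6 * of_int a * \<alpha> ^ 2)"
      "z * (\<alpha>\<^sub>2 ^ 2 - \<alpha>\<^sub>3 ^ 2) = of_int \<epsilon> * (6 * of_int a * of_int b - 2 * of_int a ^ 2 * \<alpha> - 9 * of_int b * \<alpha> ^ 2)"
      "\<alpha>\<^sub>2 ^ 2 + \<alpha>\<^sub>3 ^ 2 = 2 * of_int a - \<alpha> ^ 2" by blast+
  qed
  have member: "(\<forall>\<beta>\<in>int_adjoin \<alpha>. hopf_act (hopf_elem x y t) \<beta> \<in> int_adjoin \<alpha>) \<longleftrightarrow>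
    (\<exists>k m n. x = of_int k \<and> y = of_int m / (2 * of_int g) \<and> t = of_int n / 2 \<and> even (n - b div g * m))" for x y t
  proof -
    \<comment> \<open>This absorbs the unknown sign of z. It is harmless at the end, since replacing
      m by -m preserves the parity condition.\<close>
    define Y where "Y = of_int \<epsilon> * y"
    have act1: "hopf_act (hopf_elem x y t) 1 = of_rat (x + 2 * t) + of_rat 0 * \<alpha> + of_rat 0 * \<alpha> ^ 2"
      using Gal_hom(4)[OF \<sigma>(1), of 1] Gal_hom(4)[OF \<sigma>\<^sub>2_carrier, of 1]
      by (simp add: hopf_act_hopf_elem[OF one_N] of_rat_add of_rat_mult)
    have "hopf_act (hopf_elem x y t) \<alpha> = of_rat x * \<alpha> + of_rat t * (\<alpha>\<^sub>2 + \<alpha>\<^sub>3) + of_rat y * (z * (\<alpha>\<^sub>2 - \<alpha>\<^sub>3))"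
      by (simp add: hopf_act_hopf_elem[OF \<alpha>_in_N] \<sigma>(2) \<sigma>\<^sub>2_values)
    then have act\<alpha>: "hopf_act (hopf_elem x y t) \<alpha> = of_rat (- 4 * of_int a ^ 2 * Y)
        + of_rat (x - t + 9 * of_int b * Y) * \<alpha> + of_rat (6 * of_int a * Y) * \<alpha> ^ 2"
      unfolding vieta(1) z_diff(1)
      by (simp add: Y_def of_rat_add of_rat_diff of_rat_mult of_rat_minus of_rat_power algebra_simps)
    have "hopf_act (hopf_elem x y t) (\<alpha> ^ 2) = of_rat x * \<alpha> ^ 2 + of_rat t * (\<alpha>\<^sub>2 ^ 2 + \<alpha>\<^sub>3 ^ 2) + of_rat y * (z * (\<alpha>\<^sub>2 ^ 2 - \<alpha>\<^sub>3 ^ 2))"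
      by (simp add: hopf_act_hopf_elem[OF \<alpha>2_N] Gal_hom(8)[OF \<sigma>(1) \<alpha>_in_N] Gal_hom(8)[OF \<sigma>\<^sub>2_carrier \<alpha>_in_N] \<sigma>(2) \<sigma>\<^sub>2_values)
    then have act\<alpha>2: "hopf_act (hopf_elem x y t) (\<alpha> ^ 2) = of_rat (2 * of_int a * t + 6 * of_int a * of_int b * Y)
        + of_rat (- 2 * of_int a ^ 2 * Y) * \<alpha> + of_rat (x - t - 9 * of_int b * Y) * \<alpha> ^ 2"
      unfolding sum_sq z_diff(2)
      by (simp add: Y_def of_rat_add of_rat_diff of_rat_mult of_rat_minus of_rat_power algebra_simps)
    have "(\<forall>\<beta>\<in>int_adjoin \<alpha>. hopf_act (hopf_elem x y t) \<beta> \<in> int_adjoin \<alpha>) \<longleftrightarrow>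
        hopf_act (hopf_elem x y t) 1 \<in> int_adjoin \<alpha> \<and> hopf_act (hopf_elem x y t) \<alpha> \<in> int_adjoin \<alpha> \<and>
        hopf_act (hopf_elem x y t) (\<alpha> ^ 2) \<in> int_adjoin \<alpha>" (is "?all \<longleftrightarrow> ?gens")
    proof
      assume ?all
      moreover have "1 \<in> int_adjoin \<alpha>" "\<alpha> \<in> int_adjoin \<alpha>" "\<alpha> ^ 2 \<in> int_adjoin \<alpha>"
        using in_int_adjoin_iff[of 1 0 0] in_int_adjoin_iff[of 0 1 0] in_int_adjoin_iff[of 0 0 1] by simp_all
      ultimately show ?gens by blast
    next
      assume gens: ?gens
      \<comment> \<open>The action is Z-linear, so the three generators suffice once Z[\<alpha>] is
        closed under integral combinations.\<close>
      have add: "\<beta> + \<gamma> \<in> int_adjoin \<alpha>" if assm: "\<beta> \<in> int_adjoin \<alpha>" "\<gamma> \<in> int_adjoin \<alpha>" for \<beta> \<gamma>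
      proof -
        obtain k0 k1 k2 l0 l1 l2 where "\<beta> = of_int k0 + of_int k1 * \<alpha> + of_int k2 * \<alpha> ^ 2"
          "\<gamma> = of_int l0 + of_int l1 * \<alpha> + of_int l2 * \<alpha> ^ 2"
          using assm unfolding int_adjoin_\<alpha> by blast
        then have "\<beta> + \<gamma> = of_int (k0 + l0) + of_int (k1 + l1) * \<alpha> + of_int (k2 + l2) * \<alpha> ^ 2"
          by (simp add: algebra_simps)
        then show ?thesis unfolding int_adjoin_\<alpha> by blast
      qed
      have mult: "of_int n * \<beta> \<in> int_adjoin \<alpha>" if assm: "\<beta> \<in> int_adjoin \<alpha>" for n \<beta>
      proof -
        obtain k0 k1 k2 where "\<beta> = of_int k0 + of_int k1 * \<alpha> + of_int k2 * \<alpha> ^ 2"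
          using assm unfolding int_adjoin_\<alpha> by blast
        then have "of_int n * \<beta> = of_int (n * k0) + of_int (n * k1) * \<alpha> + of_int (n * k2) * \<alpha> ^ 2"
          by (simp add: algebra_simps)
        then show ?thesis unfolding int_adjoin_\<alpha> by blast
      qed
      show ?all
      proof
        fix \<beta> assume "\<beta> \<in> int_adjoin \<alpha>"
        then obtain k0 k1 k2 where \<beta>: "\<beta> = of_int k0 * 1 + of_int k1 * \<alpha> + of_int k2 * \<alpha> ^ 2"
          unfolding int_adjoin_\<alpha> by auto
        have N: "of_int k0 * 1 \<in> N" "of_int k1 * \<alpha> \<in> N" "of_int k2 * \<alpha> ^ 2 \<in> N"
          "of_int k0 * 1 + of_int k1 * \<alpha> \<in> N"
          using N_closed one_N \<alpha>_in_N \<alpha>2_N by simp_all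
        show "hopf_act (hopf_elem x y t) \<beta> \<in> int_adjoin \<alpha>"
          unfolding \<beta> hopf_act_add[OF N(4,3)] hopf_act_add[OF N(1,2)] hopf_act_of_int_mult[OF one_N]
            hopf_act_of_int_mult[OF \<alpha>_in_N] hopf_act_of_int_mult[OF \<alpha>2_N]
          using gens by (intro add mult) simp_all
      qed
    qed
    also have "\<dots> \<longleftrightarrow> (x + 2 * t \<in> \<int> \<and> x - t + 9 * of_int b * Y \<in> \<int> \<and> - 4 * of_int a ^ 2 * Y \<in> \<int> \<and> 6 * of_int a * Y \<in> \<int> \<and>
        2 * of_int a * t + 6 * of_int a * of_int b * Y \<in> \<int> \<and> - 2 * of_int a ^ 2 * Y \<in> \<int> \<and> x - t - 9 * of_int b * Y \<in> \<int>)"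
      unfolding act1 act\<alpha> act\<alpha>2 in_int_adjoin_iff using Ints_0 by blast
    also have "\<dots> \<longleftrightarrow> (\<exists>k m n. x = of_int k \<and> Y = of_int m / (2 * of_int g) \<and> t = of_int n / 2 \<and> even (n - b div g * m))"
      by (rule lattice_iff[OF assms])
    also have "\<dots> \<longleftrightarrow> (\<exists>k m n. x = of_int k \<and> y = of_int m / (2 * of_int g) \<and> t = of_int n / 2 \<and> even (n - b div g * m))"
    proof -
      have "(\<exists>m. Y = of_int m / (2 * of_int g) \<and> even (n - b div g * m)) \<longleftrightarrow>
          (\<exists>m. y = of_int m / (2 * of_int g) \<and> even (n - b div g * m))" for n
      proof -
        have neg: "\<exists>m. - r = of_int m / (2 * of_int g) \<and> even (n - b div g * m)"
          if ex: "\<exists>m. r = of_int m / (2 * of_int g) \<and> even (n - b div g * m)" for r :: rat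
        proof -
          obtain m where "r = of_int m / (2 * of_int g)" "even (n - b div g * m)" using ex by blast
          then have "- r = of_int (- m) / (2 * of_int g)" "even (n - b div g * (- m))" by auto
          then show ?thesis by blast
        qed
        show ?thesis using \<epsilon>(1)
        proof
          assume "\<epsilon> = - 1"
          then have "Y = - y" by (simp add: Y_def)
          show ?thesis using neg[of "- y"] neg[of y] unfolding \<open>Y = - y\<close> minus_minus by (rule iffI)
        qed (simp add: Y_def)
      qed
      then show ?thesis by blast
    qed
    finally show ?thesis .
  qed
  show ?thesis unfolding assoc_order_def hopf_galois_eq
  proof (intro equalityI subsetI)
    fix h
    assume "h \<in> {h \<in> {hopf_elem x y t | x y t. True}. \<forall>\<beta>\<in>int_adjoin \<alpha>. hopf_act h \<beta> \<in> int_adjoin \<alpha>}"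
    then obtain x y t where h: "h = hopf_elem x y t" "\<forall>\<beta>\<in>int_adjoin \<alpha>. hopf_act (hopf_elem x y t) \<beta> \<in> int_adjoin \<alpha>"
      by blast
    show "h \<in> {hopf_elem (of_int k) (of_int m / (2 * of_int g)) (of_int n / 2) | k m n. even (n - b div g * m)}"
      using h(2) unfolding member h(1) by blast
  next
    fix h
    assume "h \<in> {hopf_elem (of_int k) (of_int m / (2 * of_int g)) (of_int n / 2) | k m n. even (n - b div g * m)}"
    then obtain k m n where h: "h = hopf_elem (of_int k) (of_int m / (2 * of_int g)) (of_int n / 2)"
      and "even (n - b div g * m)" by blast
    then have "\<forall>\<beta>\<in>int_adjoin \<alpha>. hopf_act h \<beta> \<in> int_adjoin \<alpha>"
      unfolding h member by blast
    then show "h \<in> {h \<in> {hopf_elem x y t | x y t. True}. \<forall>\<beta>\<in>int_adjoin \<alpha>. hopf_act h \<beta> \<in> int_adjoin \<alpha>}"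
      using h by blast
  qed
qed

section \<open>Explicit bases for the two parities of b / g\<close>

lemma zero_eq_hopf_elem: "0 = hopf_elem 0 0 0"
  by (simp add: hopf_elem_def)

lemma is_int_basis_odd:
  assumes g: "g \<noteq> 0" and odd: "odd c"
  shows "is_int_basis {hopf_elem (of_int k) (of_int m / (2 * of_int g)) (of_int n / 2) | k m n. even (n - c * m)}
    (vector [hopf_elem 1 0 0, hopf_elem 0 (1 / of_int g) 0, hopf_elem 0 (- 1 / (2 * of_int g)) (1 / 2)] :: _ ^ 3)"
    (is "is_int_basis ?A ?v")
proof -
  have comb: "(\<Sum>i\<in>UNIV. zscale (q i) (?v $ i))
      = hopf_elem (of_int (q 1)) (of_int (2 * q 2 - q 3) / (2 * of_int g)) (of_int (q 3) / 2)" for q :: "3 \<Rightarrow> int"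
    by (simp add: sum_3 vector_3 zscale_hopf_elem hopf_elem_add hopf_elem_eq_iff g field_simps)
  show ?thesis unfolding is_int_basis_iff comb
  proof (intro conjI allI impI)
    fix q :: "3 \<Rightarrow> int" and i :: 3
    assume "hopf_elem (of_int (q 1)) (of_int (2 * q 2 - q 3) / (2 * of_int g)) (of_int (q 3) / 2) = 0"
    then have "q 1 = 0 \<and> q 2 = 0 \<and> q 3 = 0"
      unfolding zero_eq_hopf_elem hopf_elem_eq_iff using g by simp
    then have "\<forall>i. q i = 0" by (simp add: forall_3)
    then show "q i = 0" ..
  next
    show "?A = range (\<lambda>q :: 3 \<Rightarrow> int. hopf_elem (of_int (q 1)) (of_int (2 * q 2 - q 3) / (2 * of_int g)) (of_int (q 3) / 2))"
      (is "_ = range ?f")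
    proof (intro equalityI subsetI)
      fix h assume "h \<in> ?A"
      then obtain k m n where h: "h = hopf_elem (of_int k) (of_int m / (2 * of_int g)) (of_int n / 2)"
        and "even (n - c * m)" by blast
      \<comment> \<open>The combination with coefficients q has m = 2 q_2 - q_3 and n = q_3. Solving
        for q_2 = (m + n) / 2 is possible exactly under this parity condition.\<close>
      then have "even (m + n)" using odd by auto
      then obtain l where l: "m + n = 2 * l" by (rule evenE)
      define q :: "3 \<Rightarrow> int" where "q = (\<lambda>i. if i = 1 then k else if i = 2 then l else n)"
      have "h = ?f q" unfolding h by (simp add: q_def flip: l)
      then show "h \<in> range ?f" by (rule range_eqI[where x = q])
    next
      fix h assume "h \<in> range ?f"
      then obtain q where "h = ?f q" by blast
      moreover have "even (q 3 - c * (2 * q 2 - q 3))" using odd by simp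
      ultimately show "h \<in> ?A" by blast
    qed
  qed
qed

lemma is_int_basis_even:
  assumes g: "g \<noteq> 0" and even: "even c"
  shows "is_int_basis {hopf_elem (of_int k) (of_int m / (2 * of_int g)) (of_int n / 2) | k m n. even (n - c * m)}
    (vector [hopf_elem 1 0 0, hopf_elem 0 (1 / (2 * of_int g)) 0, hopf_elem 0 0 1] :: _ ^ 3)"
    (is "is_int_basis ?A ?v")
proof -
  have comb: "(\<Sum>i\<in>UNIV. zscale (q i) (?v $ i))
      = hopf_elem (of_int (q 1)) (of_int (q 2) / (2 * of_int g)) (of_int (2 * q 3) / 2)" for q :: "3 \<Rightarrow> int"
    by (simp add: sum_3 vector_3 zscale_hopf_elem hopf_elem_add)
  show ?thesis unfolding is_int_basis_iff comb
  proof (intro conjI allI impI)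
    fix q :: "3 \<Rightarrow> int" and i :: 3
    assume "hopf_elem (of_int (q 1)) (of_int (q 2) / (2 * of_int g)) (of_int (2 * q 3) / 2) = 0"
    then have "q 1 = 0 \<and> q 2 = 0 \<and> q 3 = 0"
      unfolding zero_eq_hopf_elem hopf_elem_eq_iff using g by simp
    then have "\<forall>i. q i = 0" by (simp add: forall_3)
    then show "q i = 0" ..
  next
    show "?A = range (\<lambda>q :: 3 \<Rightarrow> int. hopf_elem (of_int (q 1)) (of_int (q 2) / (2 * of_int g)) (of_int (2 * q 3) / 2))"
      (is "_ = range ?f")
    proof (intro equalityI subsetI)
      fix h assume "h \<in> ?A"
      then obtain k m n where h: "h = hopf_elem (of_int k) (of_int m / (2 * of_int g)) (of_int n / 2)"
        and "even (n - c * m)" by blast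
      \<comment> \<open>For even c the condition does not involve m, so the lattice is a direct
        product of three cyclic lattices in x, y and t.\<close>
      then have "even n" using even by simp
      then obtain l where l: "n = 2 * l" by (rule evenE)
      define q :: "3 \<Rightarrow> int" where "q = (\<lambda>i. if i = 1 then k else if i = 2 then m else l)"
      have "h = ?f q" unfolding h by (simp add: q_def l)
      then show "h \<in> range ?f" by (rule range_eqI[where x = q])
    next
      fix h assume "h \<in> range ?f"
      then obtain q where "h = ?f q" by blast
      moreover have "even (2 * q 3 - c * q 2)" using even by simp
      ultimately show "h \<in> ?A" by blast
    qed
  qed
qed

end

section \<open>The index and the two bases\<close>

theorem corollary6p4:
  fixes a b g :: int
    and f :: "int poly"
    and \<alpha> \<alpha>\<^sub>2 \<alpha>\<^sub>3 z :: "'a::field_char_0"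
    and L N M :: "'a set"
    and \<sigma> :: "'a \<Rightarrow> 'a"
    and H \<AA> :: "(('a \<Rightarrow> 'a) \<Rightarrow>\<^sub>0 'a) set"
    and w\<^sub>1 w\<^sub>2 w\<^sub>3 :: "('a \<Rightarrow> 'a) \<Rightarrow>\<^sub>0 'a"
  assumes f: "f = [:b, - a, 0, 1:]"
    and root: "poly (map_poly of_int f) \<alpha> = 0"
    and L: "L = rat_adjoin {\<alpha>}"
    and cubic: "rat_degree L = 3"
    and reduced: "\<And>p::nat. prime p \<Longrightarrow> vp p a < 2 \<or> vp p b < 3"
    and g: "g = gcd a b"
    and N: "is_normal_closure L N"
    and roots: "{x \<in> N. poly (map_poly of_int f) x = 0} = {\<alpha>, \<alpha>\<^sub>2, \<alpha>\<^sub>3}"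
    and z: "z ^ 2 = of_int (4 * a ^ 3 - 27 * b ^ 2)"
    and M: "M = rat_adjoin {z}"
    and \<sigma>: "\<sigma> \<in> carrier (Gal N \<rat>)" "\<sigma> \<alpha> = \<alpha>\<^sub>2" "\<sigma> \<alpha>\<^sub>2 = \<alpha>\<^sub>3" "\<sigma> \<alpha>\<^sub>3 = \<alpha>"
    and H: "H = hopf_galois N L M \<sigma>"
    and w\<^sub>1: "w\<^sub>1 = Poly_Mapping.single \<one>\<^bsub>Gal N \<rat>\<^esub> 1"
    and w\<^sub>2: "w\<^sub>2 = cscale z (Poly_Mapping.single \<sigma> 1
                        - Poly_Mapping.single (\<sigma> [^]\<^bsub>Gal N \<rat>\<^esub> (2::nat)) 1)"
    and w\<^sub>3: "w\<^sub>3 = Poly_Mapping.single \<sigma> 1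
                        + Poly_Mapping.single (\<sigma> [^]\<^bsub>Gal N \<rat>\<^esub> (2::nat)) 1"
    and \<AA>: "\<AA> = assoc_order H (int_adjoin \<alpha>)"
    and not3: "\<not> 3 dvd a"
  shows "gen_index \<AA> (vector [w\<^sub>1, w\<^sub>2, w\<^sub>3] :: _ ^ 3) = of_int (2 * g) \<and>
    (vp 2 a \<ge> vp 2 b \<longrightarrow>
       is_int_basis \<AA> (vector [w\<^sub>1,
                               cscale (1 / of_int g) w\<^sub>2,
                               cscale (1 / of_int (2 * g)) (- w\<^sub>2 + cscale (of_int g) w\<^sub>3)] :: _ ^ 3)) \<and>
    (vp 2 a < vp 2 b \<longrightarrow>
       is_int_basis \<AA> (vector [w\<^sub>1,
                               cscale (1 / of_int (2 * g)) w\<^sub>2,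
                               w\<^sub>3] :: _ ^ 3))"
proof -
  have eval: "poly (map_poly of_int f) x = x ^ 3 - of_int a * x + of_int b" for x :: 'a
    by (simp add: f map_poly_pCons power3_eq_cube algebra_simps)
  interpret cubic_closure a b \<alpha> \<alpha>\<^sub>2 \<alpha>\<^sub>3 z N \<sigma>
    by unfold_locales (use root roots cubic N z \<sigma> L in \<open>simp_all add: eval\<close>)
  \<comment> \<open>The case a = 0 is excluded because 3 divides 0.\<close>
  have g0: "g > 0" using not3 g by (simp add: gcd_pos_int) (metis dvd_0_right)
  define c where "c = b div g"
  have parity: "odd c \<longleftrightarrow> vp 2 a \<ge> vp 2 b"
    unfolding c_def g using not3 by (intro odd_div_gcd_iff) auto
  let ?A = "{hopf_elem (of_int k) (of_int m / (2 * of_int g)) (of_int n / 2) | k m n. even (n - c * m)}"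
  have A: "\<AA> = ?A"
    unfolding \<AA> H L M c_def by (rule assoc_order_eq[OF g not3])
  have w: "w\<^sub>1 = hopf_elem 1 0 0" "w\<^sub>2 = hopf_elem 0 1 0" "w\<^sub>3 = hopf_elem 0 0 1"
    unfolding w\<^sub>1 w\<^sub>2 w\<^sub>3 \<sigma>\<^sub>2_def[symmetric]
    by (rule poly_mapping_eqI,
        simp add: hopf_elem_def lookup_cscale lookup_add lookup_minus lookup_single when_def)+
  have v: "cscale (1 / of_int g) w\<^sub>2 = hopf_elem 0 (1 / of_int g) 0"
    "cscale (1 / of_int (2 * g)) (- w\<^sub>2 + cscale (of_int g) w\<^sub>3) = hopf_elem 0 (- 1 / (2 * of_int g)) (1 / 2)"
    "cscale (1 / of_int (2 * g)) w\<^sub>2 = hopf_elem 0 (1 / (2 * of_int g)) 0"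
  proof -
    \<comment> \<open>\<open>cscale_hopf_elem\<close> handles scalars of the form
      \<open>of_rat\<close>, so the given scalars are rewritten into that form.\<close>
    have inv: "1 / of_int n = (of_rat (1 / of_int n) :: 'a)" for n by (simp add: of_rat_divide)
    have int: "of_int n = (of_rat (of_int n) :: 'a)" for n by simp
    have "- w\<^sub>2 = cscale (of_rat (- 1)) w\<^sub>2" by (rule poly_mapping_eqI) (simp add: lookup_cscale)
    then have "- w\<^sub>2 = hopf_elem 0 (- 1) 0" unfolding w cscale_hopf_elem by simp
    then show "cscale (1 / of_int (2 * g)) (- w\<^sub>2 + cscale (of_int g) w\<^sub>3) = hopf_elem 0 (- 1 / (2 * of_int g)) (1 / 2)"
      using g0 unfolding inv by (simp add: int[of g] w(3) cscale_hopf_elem hopf_elem_add del: of_rat_of_int_eq)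
    show "cscale (1 / of_int g) w\<^sub>2 = hopf_elem 0 (1 / of_int g) 0"
      "cscale (1 / of_int (2 * g)) w\<^sub>2 = hopf_elem 0 (1 / (2 * of_int g)) 0"
      unfolding inv by (simp_all add: w cscale_hopf_elem)
  qed
  show ?thesis
  proof (cases "odd c")
    case True
    let ?v = "vector [hopf_elem 1 0 0, hopf_elem 0 (1 / of_int g) 0, hopf_elem 0 (- 1 / (2 * of_int g)) (1 / 2)] :: _ ^ 3"
    \<comment> \<open>The columns express w_1 = v_1, w_2 = g v_2 and w_3 = v_2 + 2 v_3.\<close>
    let ?P = "vector [vector [1, 0, 0], vector [0, of_int g, 1], vector [0, 0, 2]] :: rat ^ 3 ^ 3"
    have basis: "is_int_basis \<AA> ?v" unfolding A using g0 True by (intro is_int_basis_odd) auto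
    have "\<forall>j. (vector [w\<^sub>1, w\<^sub>2, w\<^sub>3] :: _ ^ 3) $ j = (\<Sum>i\<in>UNIV. cscale (of_rat (?P $ i $ j)) (?v $ i))"
      using g0 by (simp only: forall_3 sum_3 vector_3 w cscale_hopf_elem hopf_elem_add hopf_elem_eq_iff) simp
    then have "gen_index \<AA> (vector [w\<^sub>1, w\<^sub>2, w\<^sub>3] :: _ ^ 3) = \<bar>det ?P\<bar>"
      by (intro gen_index_eqI[OF basis]) blast
    also have "\<dots> = of_int (2 * g)" using g0 by (simp add: det_3 vector_3)
    finally show ?thesis using basis True parity unfolding v w(1) by auto
  next
    case False
    let ?v = "vector [hopf_elem 1 0 0, hopf_elem 0 (1 / (2 * of_int g)) 0, hopf_elem 0 0 1] :: _ ^ 3"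
    \<comment> \<open>Here only the second vector is rescaled: w_2 = 2 g v_2.\<close>
    let ?P = "vector [vector [1, 0, 0], vector [0, 2 * of_int g, 0], vector [0, 0, 1]] :: rat ^ 3 ^ 3"
    have basis: "is_int_basis \<AA> ?v" unfolding A using g0 False by (intro is_int_basis_even) auto
    have "\<forall>j. (vector [w\<^sub>1, w\<^sub>2, w\<^sub>3] :: _ ^ 3) $ j = (\<Sum>i\<in>UNIV. cscale (of_rat (?P $ i $ j)) (?v $ i))"
      using g0 by (simp only: forall_3 sum_3 vector_3 w cscale_hopf_elem hopf_elem_add hopf_elem_eq_iff) simp
    then have "gen_index \<AA> (vector [w\<^sub>1, w\<^sub>2, w\<^sub>3] :: _ ^ 3) = \<bar>det ?P\<bar>"
      by (intro gen_index_eqI[OF basis]) blast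
    also have "\<dots> = of_int (2 * g)" using g0 by (simp add: det_3 vector_3)
    finally show ?thesis using basis False parity unfolding v w(1,3) by auto
  qed
qed

end
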